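(* For every $1<p<\infty$ there is a constant $C_p$ such that for every $n$ that is a power of $2$ there exists a function $g$ on $\mathbb{R}^2$ with finite Haar support (i.e. only finitely many Haar coefficients $g_{I\times J}$ are nonzero, and $g=\sum_{I,J}g_{I\times J}h_I\otimes h_J$) satisfying $$\|g\|_{BMO_d(\mathbb{R}\otimes\mathbb{R})}= n\qquad\text{and}\qquad \|\pi^4_g\|_{L^p(\mathbb{R}^2)\to L^p(\mathbb{R}^2)}\le C_p\sqrt{n}.$$
   Context: $\mathcal{D}$ is the collection of all dyadic intervals of $\mathbb{R}$; $h_I$ is the $L^2$-normalized Haar function of $I\in\mathcal{D}$ (supported on $I$, equal to $\pm|I|^{-1/2}$ on the two dyadic halves of $I$ with opposite signs); $\bar\chi_I=\chi_I/|I|$; $(u\otimes v)(x,y)=u(x)v(y)$. For $g$ on $\mathbb{R}^2$ and a dyadic rectangle $R=I\times J$ ($I,J\in\mathcal{D}$), $g_R=g_{I\times J}=\int_{\mathbb{R}^2} g\,(h_I\otimes h_J)$. For $f$ on $\mathbb{R}^2$, $f_J(x)=\int_{\mathbb{R}} f(x,y)h_J(y)\,dy$ and $\langle f_J\rangle_I=\frac1{|I|}\int_I f_J(x)\,dx$. The dyadic product BMO norm is $\|g\|_{BMO_d(\mathbb{R}\otimes\mathbb{R})}=\sup_\Omega\big(\frac1{|\Omega|}\sum_{R\subseteq\Omega}g_R^2\big)^{1/2}$, where the supremum is over all open sets $\Omega\subset\mathbb{R}^2$ of finite positive measure and the sum over dyadic rectangles $R\subseteq \Omega$. The operator is $\pi^4_g(f)=\sum_{I,J\in\mathcal{D}}\langle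 f_J\rangle_I\; g_{I\times J}\; h_I\otimes\bar\chi_J$, a finite sum when $g$ has finite Haar support, and $\|\pi^4_g\|_{L^p\to L^p}$ is its operator norm on $L^p(\mathbb{R}^2)$. *)

theory Defs
  imports "HOL-Analysis.Analysis"
begin

(* Half-open intervals [k 2^j, (k+1) 2^j). *)
definition dyadic_intervals :: "real set set" where
  "dyadic_intervals =
     {I. \<exists>j k :: int. I = {of_int k * 2 powi j ..< of_int (k + 1) * 2 powi j}}"

(* Sign convention: positive on the left half of I. *)
definition haar :: "real set \<Rightarrow> real \<Rightarrow> real" where
  "haar I x =
     (if x \<in> I
      then (if x < (Inf I + Sup I) / 2 then 1 else - 1) / sqrt (measure lborel I)
      else 0)"

definition chi_bar :: "real set \<Rightarrow> real \<Rightarrow> real" where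
  "chi_bar I x = indicator I x / measure lborel I"

definition tensor :: "(real \<Rightarrow> real) \<Rightarrow> (real \<Rightarrow> real) \<Rightarrow> real \<times> real \<Rightarrow> real" where
  "tensor u v = (\<lambda>(x, y). u x * v y)"

definition haar_coeff :: "(real \<times> real \<Rightarrow> real) \<Rightarrow> real set \<Rightarrow> real set \<Rightarrow> real" where
  "haar_coeff g I J = (\<integral>z. g z * tensor (haar I) (haar J) z \<partial>lborel)"

definition haar_support :: "(real \<times> real \<Rightarrow> real) \<Rightarrow> (real set \<times> real set) set" where
  "haar_support g =
     {(I, J). I \<in> dyadic_intervals \<and> J \<in> dyadic_intervals \<and> haar_coeff g I J \<noteq> 0}"

definition finite_haar_support :: "(real \<times> real \<Rightarrow> real) \<Rightarrow> bool" where
  "finite_haar_support g \<longleftrightarrow>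
     finite (haar_support g) \<and>
     g = (\<lambda>z. \<Sum>(I, J)\<in>haar_support g. haar_coeff g I J * tensor (haar I) (haar J) z)"

(* Real powers on [0,\<infinity>]; meant for exponents a > 0. *)
definition enn_powr :: "ennreal \<Rightarrow> real \<Rightarrow> ennreal" where
  "enn_powr x a = (if x = top then top else ennreal (enn2real x powr a))"

definition product_bmo_norm :: "(real \<times> real \<Rightarrow> real) \<Rightarrow> ennreal" where
  "product_bmo_norm g =
     (SUP \<Omega> \<in> {\<Omega>. open \<Omega> \<and> 0 < emeasure lborel \<Omega> \<and> emeasure lborel \<Omega> < top}.
        enn_powr
          ((\<Sum>\<^sub>\<infinity>(I, J)\<in>{(I, J). I \<in> dyadic_intervals \<and> J \<in> dyadic_intervals \<and> I \<times> J \<subseteq> \<Omega>}.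
              ennreal ((haar_coeff g I J)\<^sup>2)) / emeasure lborel \<Omega>)
          (1 / 2))"

definition partial_haar_coeff :: "(real \<times> real \<Rightarrow> real) \<Rightarrow> real set \<Rightarrow> real \<Rightarrow> real" where
  "partial_haar_coeff f J x = (\<integral>y. f (x, y) * haar J y \<partial>lborel)"

definition average :: "real set \<Rightarrow> (real \<Rightarrow> real) \<Rightarrow> real" where
  "average I u = (LINT x:I|lborel. u x) / measure lborel I"

(* Terms with vanishing coefficient of g are dropped, so that the sum over all pairs of
   dyadic intervals becomes a finite one; meaningful only if g has finite Haar support. *)
definition pi4 :: "(real \<times> real \<Rightarrow> real) \<Rightarrow> (real \<times> real \<Rightarrow> real) \<Rightarrow> real \<times> real \<Rightarrow> real" where
  "pi4 g f =
     (\<lambda>z. \<Sum>(I, J)\<in>haar_support g.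
        average I (partial_haar_coeff f J) * haar_coeff g I J * tensor (haar I) (chi_bar J) z)"

definition Lp_norm :: "real \<Rightarrow> (real \<times> real \<Rightarrow> real) \<Rightarrow> ennreal" where
  "Lp_norm p f = enn_powr (\<integral>\<^sup>+z. ennreal (\<bar>f z\<bar> powr p) \<partial>lborel) (1 / p)"

(* Functions rather than almost-everywhere classes; every class has a Borel representative. *)
definition Lp :: "real \<Rightarrow> (real \<times> real \<Rightarrow> real) set" where
  "Lp p = {f. f \<in> borel_measurable lborel \<and> Lp_norm p f < top}"

definition Lp_op_norm ::
  "real \<Rightarrow> ((real \<times> real \<Rightarrow> real) \<Rightarrow> (real \<times> real \<Rightarrow> real)) \<Rightarrow> ennreal" where
  "Lp_op_norm p T = (SUP f \<in> {f \<in> Lp p. Lp_norm p f \<le> 1}. Lp_norm p (T f))"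

end

theory Submission imports Defs begin

text \<open>Take \<open>g = \<surd>n \<Sum> |I| h\<^sub>I \<otimes> h\<^sub>J\<close>, summed over the dyadic squares \<open>I \<times> J\<close> of the unit square with side
  \<open>2\<^sup>-\<^sup>a\<close>, \<open>a < n\<close>. Each of the \<open>n\<close> generations tiles the unit square, so the squared coefficients
  contribute \<open>n\<close> times its area per generation, and the BMO norm is \<open>n\<close>. On the other hand
  \<open>\<pi>\<^sup>4\<^sub>g f = \<surd>n \<Sum>\<^sub>a r\<^sub>a(x) D\<^sub>a f\<close>, where \<open>r\<^sub>a\<close>, \<open>s\<^sub>a\<close> are the Rademacher signs of generation \<open>a\<close> in \<open>x\<close>
  and in \<open>y\<close> and \<open>D\<^sub>a f\<close> averages \<open>s\<^sub>a(y) f\<close> over the squares of generation \<open>a\<close>. This is a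
  martingale obtained from \<open>f\<close> by keeping the increments \<open>s\<^sub>a D\<^sub>a f\<close> and replacing \<open>s\<^sub>a\<close> by \<open>r\<^sub>a\<close>, and
  both operations are bounded on \<open>L\<^sup>p\<close> uniformly in \<open>n\<close>: if \<open>U\<close> is Burkholder's zigzag concave
  function, then a combination of two copies of \<open>U\<close> decreases in mean from one generation of squares
  to the next.\<close>

section \<open>Burkholder's function\<close>

text \<open>The hypotheses say that \<open>c\<close> dominates both \<open>p - 1\<close> and
  \<open>1 / (p - 1)\<close>, as Burkholder's constant does. These numbers are reciprocal, so the
  larger is at least 1.\<close>

lemma burk_const_ge_1:
  assumes "1 < p" "p - 1 \<le> c" "1 \<le> c * (p - 1)"
  shows "1 \<le> (c :: real)"
  using assms by (smt (verit, ccfv_SIG) mult_left_mono mult_le_cancel_left1)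

lemma tangent_below_concave:
  fixes f f' f'' :: "real \<Rightarrow> real"
  assumes "0 < a" "a \<le> s" "a \<le> t"
    and d1: "\<And>x. a \<le> x \<Longrightarrow> (f has_real_derivative f' x) (at x)"
    and d2: "\<And>x. a \<le> x \<Longrightarrow> (f' has_real_derivative f'' x) (at x)"
    and neg: "\<And>x. a \<le> x \<Longrightarrow> f'' x \<le> 0"
  shows "f t \<le> f s + f' s * (t - s)"
proof -
  have "- f' s * (t - s) \<le> - f t - (- f s)"
    by (rule f''_imp_f'[where C = "{a..}" and f'' = "\<lambda>x. - f'' x"])
      (use assms in \<open>auto intro: DERIV_minus\<close>)
  then show ?thesis by simp
qed

text \<open>Burkholder's function below at \<open>m = |x| + |y|\<close>, \<open>e = |y| - |x|\<close>. Along a line \<open>y - x = d\<close>, \<open>e\<close> is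
  constant (\<open>d\<close> or \<open>-d\<close>) as long as \<open>x\<close> and \<open>y\<close> have the same sign.\<close>
definition branch :: "real \<Rightarrow> real \<Rightarrow> real \<Rightarrow> real \<Rightarrow> real" where
  "branch p c e m = ((1 - c) * m powr p + (1 + c) * e * m powr (p - 1)) / 2"

definition branch' :: "real \<Rightarrow> real \<Rightarrow> real \<Rightarrow> real \<Rightarrow> real" where
  "branch' p c e m = ((1 - c) * p * m powr (p - 1) + (1 + c) * e * (p - 1) * m powr (p - 2)) / 2"

text \<open>Since \<open>\<bar>e\<bar> \<le> m\<close>, nonpositivity of the second derivative
  reduces to \<open>(1 - c) * p + (1 + c) * \<bar>p - 2\<bar> \<le> 0\<close>. This is
  \<open>p - 1 \<le> c\<close> for \<open>p \<ge> 2\<close> and \<open>1 \<le> c * (p - 1)\<close>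
  for \<open>p < 2\<close>, which explains the two hypotheses on \<open>c\<close>.\<close>

lemma branch_tangent:
  assumes p: "1 < p" and c: "p - 1 \<le> c" "1 \<le> c * (p - 1)"
    and e: "e \<noteq> 0" "\<bar>e\<bar> \<le> s" "\<bar>e\<bar> \<le> t"
  shows "branch p c e t \<le> branch p c e s + branch' p c e s * (t - s)"
proof (rule tangent_below_concave[where a = "\<bar>e\<bar>"
      and f'' = "\<lambda>m. (p - 1) * m powr (p - 3) * ((1 - c) * p * m + (1 + c) * e * (p - 2)) / 2"])
  fix x assume x: "\<bar>e\<bar> \<le> x"
  with e have x0: "0 < x" by linarith
  have pw: "((\<lambda>m. m powr q) has_real_derivative q * x powr (q - 1)) (at x)" for q
    using x0 by (rule has_real_derivative_powr)
  have pw: "((\<lambda>m. a * m powr q) has_real_derivative a * (q * x powr (q - 1))) (at x)" for a q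
    by (intro DERIV_cmult has_real_derivative_powr x0)
  show "(branch p c e has_real_derivative branch' p c e x) (at x)"
    unfolding branch_def [abs_def] branch'_def
    by (rule DERIV_cong[OF DERIV_cdivide[OF DERIV_add[OF pw pw]]]) (simp add: algebra_simps)
  show "(branch' p c e has_real_derivative
      (p - 1) * x powr (p - 3) * ((1 - c) * p * x + (1 + c) * e * (p - 2)) / 2) (at x)"
    unfolding branch'_def [abs_def]
    by (rule DERIV_cong[OF DERIV_cdivide[OF DERIV_add[OF pw pw]]])
      (use x0 in \<open>simp add: field_simps powr_diff power2_eq_square power3_eq_cube\<close>)
  have c1: "1 \<le> c" by (rule burk_const_ge_1[OF p c])
  have "(1 - c) * p * x + (1 + c) * e * (p - 2) \<le> (1 - c) * p * x + (1 + c) * \<bar>p - 2\<bar> * x"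
  proof -
    have "e * (p - 2) \<le> \<bar>e\<bar> * \<bar>p - 2\<bar>"
      by (metis abs_ge_self abs_mult)
    also have "\<dots> \<le> x * \<bar>p - 2\<bar>"
      using x by (intro mult_right_mono) auto
    finally have "(1 + c) * (e * (p - 2)) \<le> (1 + c) * (x * \<bar>p - 2\<bar>)"
      using c1 by (intro mult_left_mono) auto
    then show ?thesis by (simp add: mult_ac)
  qed
  also have "\<dots> = ((1 - c) * p + (1 + c) * \<bar>p - 2\<bar>) * x" by (simp add: algebra_simps)
  also have "\<dots> \<le> 0"
  proof -
    have "(1 - c) * p + (1 + c) * \<bar>p - 2\<bar> \<le> 0"
      using c by (cases "p \<ge> 2") (auto simp: algebra_simps)
    then show ?thesis using x0 by (simp add: mult_nonpos_nonneg)
  qed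
  finally show "(p - 1) * x powr (p - 3) * ((1 - c) * p * x + (1 + c) * e * (p - 2)) / 2 \<le> 0"
    using p by (simp add: mult_nonneg_nonpos)
qed (use e in auto)

text \<open>Convexity of the \<open>p\<close>-th power in supporting-line form. It serves below on
  the diagonal \<open>x = y\<close> of Burkholder's function, for a midpoint of two values, and for
  Jensen's inequality on a square.\<close>

lemma abs_powr_tangent:
  fixes p u x :: real
  assumes p: "1 < p"
  shows "\<bar>u\<bar> powr p + p * sgn u * \<bar>u\<bar> powr (p - 1) * (x - u) \<le> \<bar>x\<bar> powr p"
proof (cases "u = 0")
  case False
  define a b where "a = \<bar>u\<bar>" and "b = \<bar>x\<bar>"
  have a: "0 < a" and b: "0 \<le> b" using False by (auto simp: a_def b_def)
  have *: "a powr p + p * a powr (p - 1) * (b - a) \<le> b powr p"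
  \<comment> \<open>The concavity lemma works on a half-line bounded away from 0, so this endpoint
    is computed by hand.\<close>
  proof (cases "b = 0")
    case True
    have "a powr p = a powr (p - 1) * a"
      using a by (simp add: powr_mult_base powr_diff)
    then have "a powr p + p * a powr (p - 1) * (b - a) = (1 - p) * a powr p"
      using True by (simp add: algebra_simps)
    then show ?thesis using p True by (simp add: mult_nonpos_nonneg)
  next
    case False
    then have "0 < b" using b by simp
    have "- (b powr p) \<le> - (a powr p) + (- (p * a powr (p - 1))) * (b - a)"
    proof (rule tangent_below_concave[where a = "min a b"
          and f'' = "\<lambda>m. - (p * ((p - 1) * m powr (p - 1 - 1)))"])
      fix m assume "min a b \<le> m"
      then have m: "0 < m" using a \<open>0 < b\<close> by auto
      show "((\<lambda>m. - (m powr p)) has_real_derivative - (p * m powr (p - 1))) (at m)"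
        by (intro DERIV_minus has_real_derivative_powr m)
      show "((\<lambda>m. - (p * m powr (p - 1))) has_real_derivative
          - (p * ((p - 1) * m powr (p - 1 - 1)))) (at m)"
        by (intro DERIV_minus DERIV_cmult has_real_derivative_powr m)
      show "- (p * ((p - 1) * m powr (p - 1 - 1))) \<le> 0" using p by simp
    qed (use a \<open>0 < b\<close> in auto)
    then show ?thesis by simp
  qed
  have "sgn u * (x - u) \<le> b - a"
    using False by (auto simp: a_def b_def sgn_if)
  then have "p * a powr (p - 1) * (sgn u * (x - u)) \<le> p * a powr (p - 1) * (b - a)"
    using p by (intro mult_left_mono) auto
  with * show ?thesis by (simp add: a_def b_def mult_ac)
qed simp

text \<open>Burkholder's special function for \<open>c = max (p - 1) (1 / (p - 1))\<close>, up to a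
  positive factor.\<close>

definition burk :: "real \<Rightarrow> real \<Rightarrow> real \<Rightarrow> real \<Rightarrow> real" where
  "burk p c x y = (\<bar>y\<bar> - c * \<bar>x\<bar>) * (\<bar>x\<bar> + \<bar>y\<bar>) powr (p - 1)"

text \<open>The line \<open>y - x = d\<close> is parametrized by \<open>m = x + y\<close>. Between
  the axes \<open>x\<close> and \<open>y\<close> have opposite signs, so
  \<open>\<bar>x\<bar> + \<bar>y\<bar> = d\<close> and the function is affine in \<open>m\<close>;
  outside, the signs agree and \<open>\<bar>x\<bar> + \<bar>y\<bar> = \<bar>m\<bar>\<close>.\<close>

lemma burk_diagonal_pieces:
  assumes "0 < d"
  shows "d \<le> m \<Longrightarrow> burk p c ((m - d) / 2) ((m + d) / 2) = branch p c d m"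
    and "\<bar>m\<bar> \<le> d \<Longrightarrow> burk p c ((m - d) / 2) ((m + d) / 2) =
           ((1 + c) * m + (1 - c) * d) / 2 * d powr (p - 1)"
    and "m \<le> - d \<Longrightarrow> burk p c ((m - d) / 2) ((m + d) / 2) = branch p c (- d) (- m)"
proof -
  assume m: "d \<le> m"
  have "m powr p = m * m powr (p - 1)" using assms m by (simp add: powr_mult_base)
  moreover have "\<bar>(m - d) / 2\<bar> = (m - d) / 2" "\<bar>(m + d) / 2\<bar> = (m + d) / 2"
    "(m - d) / 2 + (m + d) / 2 = m"
    using assms m by (auto simp: field_simps)
  ultimately show "burk p c ((m - d) / 2) ((m + d) / 2) = branch p c d m"
    by (simp only: burk_def branch_def) (simp add: field_simps)
next
  assume m: "\<bar>m\<bar> \<le> d"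
  have "\<bar>(m - d) / 2\<bar> = (d - m) / 2" "\<bar>(m + d) / 2\<bar> = (m + d) / 2"
    "(d - m) / 2 + (m + d) / 2 = d"
    using m by (auto simp: field_simps)
  then show "burk p c ((m - d) / 2) ((m + d) / 2) =
      ((1 + c) * m + (1 - c) * d) / 2 * d powr (p - 1)"
    by (simp only: burk_def) (simp add: field_simps)
next
  assume m: "m \<le> - d"
  have "(- m) powr p = (- m) * (- m) powr (p - 1)" using assms m powr_mult_base[of "- m" "p - 1"] by simp
  moreover have "\<bar>(m - d) / 2\<bar> = (d - m) / 2" "\<bar>(m + d) / 2\<bar> = (- d - m) / 2"
    "(d - m) / 2 + (- d - m) / 2 = - m"
    using assms m by (auto simp: abs_if field_simps)
  ultimately show "burk p c ((m - d) / 2) ((m + d) / 2) = branch p c (- d) (- m)"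
    by (simp only: burk_def branch_def) (simp add: field_simps)
qed

text \<open>Adding the tangent inequalities at \<open>s\<close> and at \<open>\<bar>e\<bar>\<close>
  gives monotonicity of the slope. It lets slopes anywhere on an outer piece be compared with the
  slope at the kink.\<close>

lemma branch'_mono:
  assumes p: "1 < p" and c: "p - 1 \<le> c" "1 \<le> c * (p - 1)"
    and e: "e \<noteq> 0" "\<bar>e\<bar> \<le> s"
  shows "branch' p c e s \<le> branch' p c e \<bar>e\<bar>"
proof (cases "s = \<bar>e\<bar>")
  case False
  have "branch p c e s \<le> branch p c e \<bar>e\<bar> + branch' p c e \<bar>e\<bar> * (s - \<bar>e\<bar>)"
    "branch p c e \<bar>e\<bar> \<le> branch p c e s + branch' p c e s * (\<bar>e\<bar> - s)"
    using assms by (auto intro!: branch_tangent)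
  then have "branch' p c e s * (s - \<bar>e\<bar>) \<le> branch' p c e \<bar>e\<bar> * (s - \<bar>e\<bar>)"
    by (simp add: algebra_simps)
  then show ?thesis using False e by (simp add: mult_le_cancel_right)
qed simp

text \<open>The affine middle piece has slope \<open>(1 + c) / 2 * d powr (p - 1)\<close>, and both
  kinks turn out to be concave: after cancellation the inequalities are \<open>p - 1 \<le> c\<close>
  and \<open>1 \<le> c * (p - 1)\<close>. The sign in the second one comes from the left piece being
  a branch in \<open>- m\<close>.\<close>

lemma branch'_at_kink:
  assumes p: "1 < p" and c: "p - 1 \<le> c" "1 \<le> c * (p - 1)" and d: "0 < d"
  shows "branch' p c d d \<le> (1 + c) / 2 * d powr (p - 1)"
    and "branch' p c (- d) d \<le> - ((1 + c) / 2 * d powr (p - 1))"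
proof -
  have *: "d * d powr (p - 2) = d powr (p - 1)"
    using d powr_mult_base[of d "p - 2"] by simp
  have "branch' p c d d =
      ((1 - c) * p * d powr (p - 1) + (1 + c) * (p - 1) * (d * d powr (p - 2))) / 2"
    by (simp add: branch'_def)
  then have 1: "branch' p c d d = ((1 - c) * p + (1 + c) * (p - 1)) / 2 * d powr (p - 1)"
    unfolding * by (simp add: algebra_simps)
  have "branch' p c (- d) d =
      ((1 - c) * p * d powr (p - 1) - (1 + c) * (p - 1) * (d * d powr (p - 2))) / 2"
    by (simp add: branch'_def)
  then have 2: "branch' p c (- d) d = ((1 - c) * p - (1 + c) * (p - 1)) / 2 * d powr (p - 1)"
    unfolding * by (simp add: algebra_simps)
  have "((1 - c) * p + (1 + c) * (p - 1)) / 2 \<le> (1 + c) / 2"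
    using c by (simp add: algebra_simps)
  then show "branch' p c d d \<le> (1 + c) / 2 * d powr (p - 1)"
    unfolding 1 by (rule mult_right_mono) simp
  have "((1 - c) * p - (1 + c) * (p - 1)) / 2 \<le> - ((1 + c) / 2)"
    using c by (simp add: field_simps)
  then have "((1 - c) * p - (1 + c) * (p - 1)) / 2 * d powr (p - 1)
      \<le> - ((1 + c) / 2) * d powr (p - 1)"
    by (rule mult_right_mono) simp
  then show "branch' p c (- d) d \<le> - ((1 + c) / 2 * d powr (p - 1))"
    unfolding 2 by simp
qed

text \<open>Concave pieces glued at concave kinks form a concave function. Concavity is stated as a
  supporting line at every point, which yields the midpoint inequality at once.\<close>

lemma burk_diagonal_support:
  assumes p: "1 < p" and c: "p - 1 \<le> c" "1 \<le> c * (p - 1)" and d: "0 < d"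
  defines "f \<equiv> \<lambda>m. burk p c ((m - d) / 2) ((m + d) / 2)"
  shows "\<exists>k. \<forall>t. f t \<le> f s + k * (t - s)"
proof -
  define k0 where "k0 = (1 + c) / 2 * d powr (p - 1)"
  \<comment> \<open>The affine middle piece extended to the whole line; by the kink inequalities it
    dominates \<open>f\<close> everywhere.\<close>
  define L where "L m = k0 * m + (1 - c) / 2 * d * d powr (p - 1)" for m
  note pieces = burk_diagonal_pieces[OF d, of _ p c, folded f_def]
  have mid: "f m = L m" if "\<bar>m\<bar> \<le> d" for m
    using pieces(2)[OF that] by (simp add: L_def k0_def f_def field_simps)
  have up: "f m = branch p c d m" if "d \<le> m" for m
    using pieces(1)[OF that] by (simp add: f_def)
  have low: "f m = branch p c (- d) (- m)" if "m \<le> - d" for m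
    using pieces(3)[OF that] by (simp add: f_def)
  note tan = branch_tangent[OF p c]
  note kink = branch'_at_kink[OF p c d, folded k0_def]
  have Ld: "branch p c d d = L d" "branch p c (- d) d = L (- d)"
    using mid[of d] mid[of "- d"] up[of d] low[of "- d"] d by auto
  have le_L: "f t \<le> L t" for t
  proof -
    consider "\<bar>t\<bar> \<le> d" | "d \<le> t" | "t \<le> - d" by linarith
    then show ?thesis
    proof cases
      case 2
      have "branch p c d t \<le> L d + branch' p c d d * (t - d)"
        using tan[of d d t] 2 d Ld by simp
      also have "branch' p c d d * (t - d) \<le> k0 * (t - d)"
        using kink 2 by (intro mult_right_mono) auto
      finally show ?thesis using up[OF 2] by (simp add: L_def algebra_simps)
    next
      case 3
      have "branch p c (- d) (- t) \<le> L (- d) + branch' p c (- d) d * (- t - d)"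
        using tan[of "- d" d "- t"] 3 d Ld by simp
      also have "branch' p c (- d) d * (- t - d) \<le> - k0 * (- t - d)"
        using kink 3 by (intro mult_right_mono) auto
      finally show ?thesis using low[OF 3] by (simp add: L_def algebra_simps)
    qed (simp add: mid)
  qed
  consider "\<bar>s\<bar> \<le> d" | "d \<le> s" | "s \<le> - d" by linarith
  then show ?thesis
  proof cases
    case 1
    have "f t \<le> f s + k0 * (t - s)" for t
      using le_L[of t] mid[OF 1] by (simp add: L_def algebra_simps)
    then show ?thesis by blast
  next
    case 2
    define k where "k = branch' p c d s"
    have k: "k \<le> k0"
      using branch'_mono[OF p c, of d s] 2 d kink by (simp add: k_def)
    have fs: "f s = branch p c d s" by (rule up[OF 2])
    have "f t \<le> f s + k * (t - s)" for t
    proof (cases "d \<le> t")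
      case True
      then show ?thesis using tan[of d s t] 2 d up fs by (simp add: k_def)
    next
      case False
      \<comment> \<open>At the kink the tangent line is above \<open>L\<close>, and its slope is
        smaller; so to the left it stays above \<open>L\<close>, which dominates
        \<open>f\<close>.\<close>
      have "L d \<le> f s + k * (d - s)"
        using tan[of d s d] 2 d fs Ld by (simp add: k_def)
      moreover have "k0 * (t - d) \<le> k * (t - d)"
        using k False by (intro mult_right_mono_neg) auto
      ultimately show ?thesis using le_L[of t] by (simp add: L_def algebra_simps)
    qed
    then show ?thesis by blast
  next
    case 3
    define k where "k = - branch' p c (- d) (- s)"
    have k: "k0 \<le> k"
      using branch'_mono[OF p c, of "- d" "- s"] 3 d kink by (simp add: k_def)
    have fs: "f s = branch p c (- d) (- s)" by (rule low[OF 3])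
    have "f t \<le> f s + k * (t - s)" for t
    proof (cases "t \<le> - d")
      case True
      then show ?thesis using tan[of "- d" "- s" "- t"] 3 d low fs
        by (simp add: k_def algebra_simps)
    next
      case False
      have "L (- d) \<le> f s + k * (- d - s)"
        using tan[of "- d" "- s" d] 3 d fs Ld by (simp add: k_def algebra_simps)
      moreover have "k0 * (t + d) \<le> k * (t + d)"
        using k False by (intro mult_right_mono) auto
      ultimately show ?thesis using le_L[of t] by (simp add: L_def algebra_simps)
    qed
    then show ?thesis by blast
  qed
qed

lemma burk_symmetries:
  "burk p c (- x) y = burk p c x y" "burk p c x (- y) = burk p c x y"
  by (simp_all add: burk_def)

text \<open>For \<open>x < y\<close> the supporting line at \<open>m = x + y\<close> is evaluated at
  \<open>m + 2 * t\<close> and \<open>m - 2 * t\<close>, where the slope terms cancel. The case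
  \<open>y < x\<close> follows by changing both signs.\<close>

lemma burk_zigzag:
  assumes p: "1 < p" and c: "p - 1 \<le> c" "1 \<le> c * (p - 1)"
  shows "burk p c (x + t) (y + t) + burk p c (x - t) (y - t) \<le> 2 * burk p c x y"
proof -
  have pos: "burk p c (x + t) (y + t) + burk p c (x - t) (y - t) \<le> 2 * burk p c x y"
    if "x < y" for x y t
  proof -
    have "\<exists>k. \<forall>m. burk p c ((m - (y - x)) / 2) ((m + (y - x)) / 2)
        \<le> burk p c (((x + y) - (y - x)) / 2) (((x + y) + (y - x)) / 2) + k * (m - (x + y))"
      by (rule burk_diagonal_support[OF p c]) (use that in simp)
    then obtain k where k: "\<And>m. burk p c ((m - (y - x)) / 2) ((m + (y - x)) / 2)
        \<le> burk p c (((x + y) - (y - x)) / 2) (((x + y) + (y - x)) / 2) + k * (m - (x + y))"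
      by blast
    have e: "(x + y + 2 * t - (y - x)) / 2 = x + t" "(x + y + 2 * t + (y - x)) / 2 = y + t"
      "(x + y - 2 * t - (y - x)) / 2 = x - t" "(x + y - 2 * t + (y - x)) / 2 = y - t"
      "((x + y) - (y - x)) / 2 = x" "((x + y) + (y - x)) / 2 = y"
      by (auto simp: field_simps)
    have "burk p c (x + t) (y + t) \<le> burk p c x y + k * (2 * t)"
      "burk p c (x - t) (y - t) \<le> burk p c x y - k * (2 * t)"
      using k[of "x + y + 2 * t"] k[of "x + y - 2 * t"] unfolding e by auto
    then show ?thesis by simp
  qed
  consider "x < y" | "y < x" | "x = y" by linarith
  then show ?thesis
  proof cases
    case 2
    then show ?thesis
      using pos[of "- x" "- y" t] burk_symmetries[of p c "x + t" "- (y + t)"]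
        burk_symmetries[of p c "x - t" "- (y - t)"] burk_symmetries[of p c x "- y"]
      by (simp add: burk_def abs_minus_commute add.commute)
  next
    case 3
    \<comment> \<open>On the diagonal the function is a nonpositive multiple of the convex function
      \<open>\<bar>s\<bar> powr p\<close>, because \<open>1 \<le> c\<close>.\<close>
    have c1: "1 \<le> c" by (rule burk_const_ge_1[OF p c])
    have b: "burk p c s s = - ((c - 1) * 2 powr (p - 1)) * \<bar>s\<bar> powr p" for s :: real
    proof -
      have "\<bar>s\<bar> powr p = \<bar>s\<bar> * \<bar>s\<bar> powr (p - 1)" by (simp add: powr_mult_base)
      moreover have "(\<bar>s\<bar> + \<bar>s\<bar>) powr (p - 1) = 2 powr (p - 1) * \<bar>s\<bar> powr (p - 1)"
        by (simp flip: powr_mult)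
      ultimately show ?thesis by (simp add: burk_def algebra_simps)
    qed
    have "2 * \<bar>x\<bar> powr p \<le> \<bar>x + t\<bar> powr p + \<bar>x - t\<bar> powr p"
      using abs_powr_tangent[OF p, of x "x + t"] abs_powr_tangent[OF p, of x "x - t"] by simp
    then have "(c - 1) * 2 powr (p - 1) * (2 * \<bar>x\<bar> powr p)
        \<le> (c - 1) * 2 powr (p - 1) * (\<bar>x + t\<bar> powr p + \<bar>x - t\<bar> powr p)"
      using c1 by (intro mult_left_mono) auto
    then show ?thesis unfolding 3[symmetric] b by (simp add: algebra_simps)
  qed (rule pos)
qed

lemma burk_zigzag':
  assumes p: "1 < p" and c: "p - 1 \<le> c" "1 \<le> c * (p - 1)"
  shows "burk p c (x + t) (y - t) + burk p c (x - t) (y + t) \<le> 2 * burk p c x y"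
  using burk_zigzag[OF assms, of x t "- y"] burk_symmetries(2)[of p c "x + t" "y - t"]
    burk_symmetries(2)[of p c "x - t" "y + t"] burk_symmetries(2)[of p c x y]
  by simp

text \<open>If \<open>2 * c * \<bar>x\<bar> \<le> \<bar>y\<bar>\<close>, the factor
  \<open>\<bar>y\<bar> - c * \<bar>x\<bar>\<close> is at least \<open>\<bar>y\<bar> / 2\<close>.
  Otherwise both \<open>\<bar>y\<bar> powr p\<close> and the negative part of the function are
  controlled by \<open>\<bar>x\<bar> powr p\<close>. The constant is not meant to be sharp.\<close>

lemma burk_lower_bound:
  assumes p: "1 < p" and c: "0 < c"
  shows "\<bar>y\<bar> powr p / 2 \<le> burk p c x y + (1 + 2 * c) powr p * (1 + c) * \<bar>x\<bar> powr p"
proof -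
  have split: "a powr p = a * a powr (p - 1)" if "0 \<le> a" for a
    using powr_mult_base[OF that, of "p - 1"] by simp
  show ?thesis
  proof (cases "2 * c * \<bar>x\<bar> \<le> \<bar>y\<bar>")
    case True
    have "\<bar>y\<bar> powr p / 2 = \<bar>y\<bar> / 2 * \<bar>y\<bar> powr (p - 1)" by (simp add: split)
    also have "\<dots> \<le> (\<bar>y\<bar> - c * \<bar>x\<bar>) * (\<bar>x\<bar> + \<bar>y\<bar>) powr (p - 1)"
      using True p c by (intro mult_mono powr_mono2) (auto simp: field_simps)
    also have "\<dots> = burk p c x y" by (simp add: burk_def)
    also have "\<dots> \<le> burk p c x y + (1 + 2 * c) powr p * (1 + c) * \<bar>x\<bar> powr p"
      using c by simp
    finally show ?thesis .
  next
    case False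
    define K where "K = (1 + 2 * c) powr p * \<bar>x\<bar> powr p"
    have K: "K = ((1 + 2 * c) * \<bar>x\<bar>) powr p" using c by (simp add: K_def powr_mult)
    have le: "\<bar>x\<bar> + \<bar>y\<bar> \<le> (1 + 2 * c) * \<bar>x\<bar>" using False by (simp add: algebra_simps)
    have "\<bar>y\<bar> powr p \<le> K"
      unfolding K using p le by (intro powr_mono2) auto
    moreover have "0 \<le> \<bar>y\<bar> powr p" by simp
    moreover have "c * (\<bar>x\<bar> * (\<bar>x\<bar> + \<bar>y\<bar>) powr (p - 1)) \<le> c * K"
    proof (rule mult_left_mono)
      have "1 * \<bar>x\<bar> \<le> (1 + 2 * c) * \<bar>x\<bar>" using c by (intro mult_right_mono) auto
      then show "\<bar>x\<bar> * (\<bar>x\<bar> + \<bar>y\<bar>) powr (p - 1) \<le> K"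
        unfolding K using p le c
        by (subst split) (auto intro!: mult_mono powr_mono2)
    qed (use c in simp)
    moreover have "- (c * (\<bar>x\<bar> * (\<bar>x\<bar> + \<bar>y\<bar>) powr (p - 1))) \<le> burk p c x y"
      by (simp add: burk_def algebra_simps)
    moreover have "(1 + 2 * c) powr p * (1 + c) * \<bar>x\<bar> powr p = K + c * K"
      by (simp add: K_def algebra_simps)
    ultimately show ?thesis by linarith
  qed
qed

section \<open>The martingale transform on the tree of dyadic squares\<close>

text \<open>The state is the average \<open>u\<close> of \<open>f\<close>, its \<open>\<plusminus>1\<close> transform \<open>z\<close> and the target martingale \<open>v\<close>. The average
  \<open>(u + z) / 2\<close> retains exactly the increments \<open>s\<^sub>a D\<^sub>a f\<close>; the first summand compares \<open>v\<close> with it, the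
  second one compares \<open>z\<close> with \<open>u\<close>.\<close>
definition bellman :: "real \<Rightarrow> real \<Rightarrow> real \<Rightarrow> real \<Rightarrow> real \<Rightarrow> real" where
  "bellman p c u z v =
     burk p c ((u + z) / 2) v + (1 + 2 * c) powr p * (1 + c) * burk p c u z"

text \<open>Here \<open>u1\<close>, \<open>u2\<close> are the averages over the two left children
  (lower, upper), \<open>u3\<close>, \<open>u4\<close> over the right ones. In the first summand
  \<open>w\<close> moves by the sign of the \<open>y\<close>-half and \<open>v\<close> by that of
  the \<open>x\<close>-half, so each sign pair occurs once and two zigzag inequalities suffice. In
  the second summand the children are first merged within each \<open>y\<close>-half, where
  \<open>u\<close> and \<open>z\<close> move oppositely, and then across the halves, where they move
  together.\<close>

lemma bellman_four_points:
  assumes p: "1 < p" and c: "p - 1 \<le> c" "1 \<le> c * (p - 1)"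
    and u: "u = (u1 + u2 + u3 + u4) / 4" and a: "a = (u1 - u2 + u3 - u4) / 4"
  shows "bellman p c u1 (z + 2 * a - (u1 - u)) (v + a) + bellman p c u2 (z - 2 * a - (u2 - u)) (v + a)
       + bellman p c u3 (z + 2 * a - (u3 - u)) (v - a) + bellman p c u4 (z - 2 * a - (u4 - u)) (v - a)
       \<le> 4 * bellman p c u z v"
proof -
  define w where "w = (u + z) / 2"
  have w: "(u1 + (z + 2 * a - (u1 - u))) / 2 = w + a" "(u2 + (z - 2 * a - (u2 - u))) / 2 = w - a"
    "(u3 + (z + 2 * a - (u3 - u))) / 2 = w + a" "(u4 + (z - 2 * a - (u4 - u))) / 2 = w - a"
    by (auto simp: w_def field_simps)
  have 1: "burk p c (w + a) (v + a) + burk p c (w - a) (v - a) \<le> 2 * burk p c w v"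
    "burk p c (w + a) (v - a) + burk p c (w - a) (v + a) \<le> 2 * burk p c w v"
    by (rule burk_zigzag[OF p c] burk_zigzag'[OF p c])+
  have 2: "burk p c u1 (z + 2 * a - (u1 - u)) + burk p c u3 (z + 2 * a - (u3 - u))
      \<le> 2 * burk p c (u + a) (z + a)"
  proof -
    have "u + a + (u1 - u3) / 2 = u1" "u + a - (u1 - u3) / 2 = u3"
      "z + a - (u1 - u3) / 2 = z + 2 * a - (u1 - u)" "z + a + (u1 - u3) / 2 = z + 2 * a - (u3 - u)"
      unfolding u a by (auto simp: field_simps)
    then show ?thesis using burk_zigzag'[OF p c, of "u + a" "(u1 - u3) / 2" "z + a"] by (simp only:)
  qed
  have 3: "burk p c u2 (z - 2 * a - (u2 - u)) + burk p c u4 (z - 2 * a - (u4 - u))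
      \<le> 2 * burk p c (u - a) (z - a)"
  proof -
    have "u - a + (u2 - u4) / 2 = u2" "u - a - (u2 - u4) / 2 = u4"
      "z - a - (u2 - u4) / 2 = z - 2 * a - (u2 - u)" "z - a + (u2 - u4) / 2 = z - 2 * a - (u4 - u)"
      unfolding u a by (auto simp: field_simps)
    then show ?thesis using burk_zigzag'[OF p c, of "u - a" "(u2 - u4) / 2" "z - a"] by (simp only:)
  qed
  have 4: "burk p c (u + a) (z + a) + burk p c (u - a) (z - a) \<le> 2 * burk p c u z"
    by (rule burk_zigzag[OF p c])
  define L where "L = (1 + 2 * c) powr p * (1 + c)"
  have "0 \<le> L" using burk_const_ge_1[OF p c] by (simp add: L_def)
  moreover have "burk p c u1 (z + 2 * a - (u1 - u)) + burk p c u2 (z - 2 * a - (u2 - u))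
      + burk p c u3 (z + 2 * a - (u3 - u)) + burk p c u4 (z - 2 * a - (u4 - u)) \<le> 4 * burk p c u z"
    using 2 3 4 by linarith
  ultimately have "L * (burk p c u1 (z + 2 * a - (u1 - u)) + burk p c u2 (z - 2 * a - (u2 - u))
      + burk p c u3 (z + 2 * a - (u3 - u)) + burk p c u4 (z - 2 * a - (u4 - u)))
      \<le> L * (4 * burk p c u z)"
    by (intro mult_left_mono)
  then show ?thesis
    using 1 unfolding bellman_def w L_def[symmetric] w_def[symmetric] by (simp add: algebra_simps)
qed

lemma bellman_initial:
  assumes p: "1 < p" and c: "p - 1 \<le> c" "1 \<le> c * (p - 1)"
  shows "bellman p c u u 0 \<le> 0"
proof -
  note c1 = burk_const_ge_1[OF p c]
  have "burk p c ((u + u) / 2) 0 \<le> 0"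
    using c1 by (simp add: burk_def mult_nonpos_nonneg)
  moreover have "burk p c u u \<le> 0"
  proof -
    have "\<bar>u\<bar> - c * \<bar>u\<bar> = (1 - c) * \<bar>u\<bar>" by (simp add: algebra_simps)
    also have "\<dots> \<le> 0" using c1 by (simp add: mult_nonpos_nonneg)
    finally show ?thesis unfolding burk_def by (rule mult_nonpos_nonneg) simp
  qed
  ultimately show ?thesis
    unfolding bellman_def using c1 by (intro add_nonpos_nonpos mult_nonneg_nonpos) auto
qed

definition burk_const :: "real \<Rightarrow> real \<Rightarrow> real" where
  "burk_const p c = (1 + 2 * c) powr p * (1 + c) * (1 / 2 + (1 + 2 * c) powr p * (1 + c))"

text \<open>\<open>burk_lower_bound\<close> is applied twice: it controls \<open>v\<close> by
  \<open>w = (u + z) / 2\<close>, convexity controls \<open>w\<close> by \<open>u\<close> and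
  \<open>z\<close>, and then \<open>z\<close> is controlled by \<open>u\<close>. The loss of the
  first application is exactly the weight of \<open>burk p c u z\<close> in
  \<open>bellman\<close>.\<close>

lemma bellman_lower_bound:
  assumes p: "1 < p" and c: "0 < c"
  shows "\<bar>v\<bar> powr p / 2 \<le> bellman p c u z v + burk_const p c * \<bar>u\<bar> powr p"
proof -
  define K where "K = (1 + 2 * c) powr p * (1 + c)"
  have K: "0 \<le> K" using c by (simp add: K_def)
  note lower = burk_lower_bound[OF p c, folded K_def]
  define w where "w = (u + z) / 2"
  have "\<bar>w\<bar> powr p \<le> (\<bar>u\<bar> powr p + \<bar>z\<bar> powr p) / 2"
  proof -
    have "p * sgn w * \<bar>w\<bar> powr (p - 1) * (u - w) + p * sgn w * \<bar>w\<bar> powr (p - 1) * (z - w) = 0"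
      unfolding distrib_left[symmetric] by (simp add: w_def field_simps)
    then show ?thesis
      using abs_powr_tangent[OF p, of w u] abs_powr_tangent[OF p, of w z] by simp
  qed
  also have "\<dots> \<le> \<bar>u\<bar> powr p / 2 + (burk p c u z + K * \<bar>u\<bar> powr p)"
    using lower[of z u] by (simp add: add_divide_distrib)
  finally have "K * \<bar>w\<bar> powr p \<le> K * (\<bar>u\<bar> powr p / 2 + (burk p c u z + K * \<bar>u\<bar> powr p))"
    using K by (rule mult_left_mono)
  then show ?thesis
    using lower[of v w] unfolding bellman_def burk_const_def K_def[symmetric] w_def[symmetric]
    by (simp add: algebra_simps)
qed

section \<open>Discrete martingales indexed by generation and position\<close>

definition half_sign :: "nat \<Rightarrow> real" where
  "half_sign i = (if even i then 1 else - 1)"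

text \<open>The quantity \<open>D\<^sub>m f\<close> of the opening, when \<open>u m i j\<close> is
  the average of \<open>f\<close> over the square number \<open>(i, j)\<close> of generation
  \<open>m\<close>. Children have indices \<open>2 * i\<close>, \<open>2 * i + 1\<close> and
  \<open>2 * j\<close>, \<open>2 * j + 1\<close>; the sign is positive on the lower half in
  \<open>y\<close>.\<close>

definition ydiff :: "(nat \<Rightarrow> nat \<Rightarrow> nat \<Rightarrow> real) \<Rightarrow> nat \<Rightarrow> nat \<Rightarrow> nat \<Rightarrow> real" where
  "ydiff u m i j = (u (Suc m) (2 * i) (2 * j) - u (Suc m) (2 * i) (2 * j + 1)
     + u (Suc m) (2 * i + 1) (2 * j) - u (Suc m) (2 * i + 1) (2 * j + 1)) / 4"

text \<open>The target martingale \<open>v\<close>, read along the path from the root: the parent of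
  a square is found by \<open>div 2\<close>, and the parity of \<open>i\<close> is the Rademacher
  sign in \<open>x\<close>.\<close>

fun shifted :: "(nat \<Rightarrow> nat \<Rightarrow> nat \<Rightarrow> real) \<Rightarrow> nat \<Rightarrow> nat \<Rightarrow> nat \<Rightarrow> real" where
  "shifted u 0 i j = 0"
| "shifted u (Suc m) i j = shifted u m (i div 2) (j div 2)
     + half_sign i * ydiff u m (i div 2) (j div 2)"

text \<open>The \<open>\<plusminus>1\<close> martingale transform that keeps the sign of the increments coming from halving
  squares in \<open>y\<close> and flips the sign of those coming from halving them in \<open>x\<close>.\<close>
fun flipped :: "(nat \<Rightarrow> nat \<Rightarrow> nat \<Rightarrow> real) \<Rightarrow> nat \<Rightarrow> nat \<Rightarrow> nat \<Rightarrow> real" where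
  "flipped u 0 i j = u 0 i j"
| "flipped u (Suc m) i j = flipped u m (i div 2) (j div 2)
     + 2 * half_sign j * ydiff u m (i div 2) (j div 2) - (u (Suc m) i j - u m (i div 2) (j div 2))"

lemma sum_lessThan_double:
  fixes f :: "nat \<Rightarrow> 'a :: comm_monoid_add"
  shows "(\<Sum>i<2 * N. f i) = (\<Sum>i<N. f (2 * i) + f (2 * i + 1))"
  by (induction N) (auto simp: add.assoc)

text \<open>The four-point inequality propagates the nonpositive initial value, so the sum of
  \<open>B\<close> over each generation is at most 0. The pointwise lower bound for
  \<open>bellman\<close> then compares the two sums with a constant independent of
  \<open>n\<close>.\<close>

lemma shifted_Lp_bound:
  assumes p: "1 < p" and c: "p - 1 \<le> c" "1 \<le> c * (p - 1)"
    and u: "\<And>m i j. u m i j = (u (Suc m) (2 * i) (2 * j) + u (Suc m) (2 * i) (2 * j + 1)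
       + u (Suc m) (2 * i + 1) (2 * j) + u (Suc m) (2 * i + 1) (2 * j + 1)) / 4"
  shows "(\<Sum>i<2 ^ n. \<Sum>j<2 ^ n. \<bar>shifted u n i j\<bar> powr p)
    \<le> 2 * burk_const p c * (\<Sum>i<2 ^ n. \<Sum>j<2 ^ n. \<bar>u n i j\<bar> powr p)"
proof -
  define B where "B m i j = bellman p c (u m i j) (flipped u m i j) (shifted u m i j)" for m i j
  have step: "B (Suc m) (2 * i) (2 * j) + B (Suc m) (2 * i) (2 * j + 1)
      + B (Suc m) (2 * i + 1) (2 * j) + B (Suc m) (2 * i + 1) (2 * j + 1) \<le> 4 * B m i j" for m i j
    using bellman_four_points[OF p c u[of m i j] ydiff_def[of u m i j],
        of "flipped u m i j" "shifted u m i j"]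
    by (simp add: B_def half_sign_def)
  have neg: "(\<Sum>i<2 ^ n. \<Sum>j<2 ^ n. B n i j) \<le> 0" for n
  proof (induction n)
    case 0
    then show ?case using bellman_initial[OF p c] by (simp add: B_def)
  next
    case (Suc n)
    have "(\<Sum>i<2 ^ Suc n. \<Sum>j<2 ^ Suc n. B (Suc n) i j)
       = (\<Sum>i<2 ^ n. \<Sum>j<2 ^ n. B (Suc n) (2 * i) (2 * j) + B (Suc n) (2 * i) (2 * j + 1)
      + B (Suc n) (2 * i + 1) (2 * j) + B (Suc n) (2 * i + 1) (2 * j + 1))"
      by (simp only: power_Suc sum_lessThan_double flip: sum.distrib) (simp add: add.assoc)
    also have "\<dots> \<le> (\<Sum>i<2 ^ n. \<Sum>j<2 ^ n. 4 * B n i j)"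
      by (intro sum_mono step)
    also have "\<dots> = 4 * (\<Sum>i<2 ^ n. \<Sum>j<2 ^ n. B n i j)"
      by (simp only: sum_distrib_left)
    finally show ?case using Suc.IH by linarith
  qed
  have "0 < c" using burk_const_ge_1[OF p c] by simp
  have "(\<Sum>i<2 ^ n. \<Sum>j<2 ^ n. \<bar>shifted u n i j\<bar> powr p / 2)
     \<le> (\<Sum>i<2 ^ n. \<Sum>j<2 ^ n. B n i j + burk_const p c * \<bar>u n i j\<bar> powr p)"
    unfolding B_def by (intro sum_mono bellman_lower_bound[OF p \<open>0 < c\<close>])
  also have "\<dots> = (\<Sum>i<2 ^ n. \<Sum>j<2 ^ n. B n i j)
      + burk_const p c * (\<Sum>i<2 ^ n. \<Sum>j<2 ^ n. \<bar>u n i j\<bar> powr p)"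
    by (simp add: sum.distrib sum_distrib_left)
  finally show ?thesis
    using neg[of n] by (simp flip: sum_divide_distrib)
qed

section \<open>Haar functions\<close>

definition dyadic :: "int \<Rightarrow> int \<Rightarrow> real set" where
  "dyadic j k = {of_int k * 2 powi j ..< of_int (k + 1) * 2 powi j}"

text \<open>Membership in a dyadic interval becomes an equation between integers, and nesting of
  intervals becomes integer division.\<close>

definition dyadic_index :: "int \<Rightarrow> real \<Rightarrow> int" where
  "dyadic_index j x = \<lfloor>x / 2 powi j\<rfloor>"

lemma dyadic_intervals_eq: "dyadic_intervals = {dyadic j k | j k. True}"
  by (auto simp: dyadic_intervals_def dyadic_def)

lemma dyadic_in_dyadic_intervals [simp]: "dyadic j k \<in> dyadic_intervals"
  by (auto simp: dyadic_intervals_eq)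

lemma mem_dyadic_iff: "x \<in> dyadic j k \<longleftrightarrow> dyadic_index j x = k"
  by (auto simp: dyadic_def dyadic_index_def floor_eq_iff field_simps)

lemma dyadic_index_coarser:
  "dyadic_index (j + int N) x = dyadic_index j x div 2 ^ N"
  using floor_divide_real_eq_div[of "2 ^ N" "x / 2 powi j"]
  by (simp add: dyadic_index_def power_int_add)

lemma dyadic_index_half: "dyadic_index j x = dyadic_index (j - 1) x div 2"
  using dyadic_index_coarser[of "j - 1" 1 x] by simp

lemma dyadic_measurable [measurable, simp]: "dyadic j k \<in> sets borel"
  by (simp add: dyadic_def)

lemma dyadic_less: "of_int k * 2 powi j < (of_int (k + 1) * 2 powi j :: real)"
  by simp

lemma emeasure_dyadic [simp]: "emeasure lborel (dyadic j k) = ennreal (2 powi j)"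
  unfolding dyadic_def using dyadic_less[of k j]
  by (subst emeasure_lborel_Ico) (simp_all add: algebra_simps)

lemma measure_dyadic [simp]: "measure lborel (dyadic j k) = 2 powi j"
  by (simp add: measure_def)

lemma dyadic_eq_iff [simp]: "dyadic j k = dyadic j' k' \<longleftrightarrow> j = j' \<and> k = k'"
proof
  assume *: "dyadic j k = dyadic j' k'"
  then have "(2::real) powi j = 2 powi j'" by (metis measure_dyadic)
  then have j: "j = j'" 
    by (metis one_less_numeral_iff power_int_strict_increasing semiring_norm(76) less_irrefl linorder_neqE_linordered_idom)
  have "of_int k * 2 powi j \<in> dyadic j k" by (simp add: dyadic_def)
  then have "of_int k * 2 powi j \<in> dyadic j k'" using * j by simp
  then have "dyadic_index j (of_int k * 2 powi j) = k'" by (simp add: mem_dyadic_iff)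
  then show "j = j' \<and> k = k'" using j by (simp add: dyadic_index_def)
qed auto

lemma haar_dyadic:
  "haar (dyadic j k) x =
     (indicator (dyadic (j - 1) (2 * k)) x - indicator (dyadic (j - 1) (2 * k + 1)) x)
       / sqrt (2 powi j)"
proof -
  have "Inf (dyadic j k) = of_int k * 2 powi j" "Sup (dyadic j k) = of_int (k + 1) * 2 powi j"
    unfolding dyadic_def using dyadic_less[of k j] by (simp_all add: cInf_atLeastLessThan cSup_atLeastLessThan)
  then have mid: "(Inf (dyadic j k) + Sup (dyadic j k)) / 2 = of_int (2 * k + 1) * 2 powi (j - 1)"
    by (simp add: power_int_diff field_simps)
  have left: "x < of_int (2 * k + 1) * 2 powi (j - 1) \<longleftrightarrow> dyadic_index (j - 1) x < 2 * k + 1"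
    by (simp add: dyadic_index_def floor_less_iff field_simps)
  show ?thesis
    unfolding haar_def mid left
    by (auto simp: mem_dyadic_iff indicator_def dyadic_index_half[of j] split: if_splits)
qed

lemma haar_eq_index:
  "haar (dyadic j k) x =
     (if dyadic_index j x = k then (if even (dyadic_index (j - 1) x) then 1 else - 1) / sqrt (2 powi j)
      else 0)"
  unfolding haar_dyadic dyadic_index_half[of j]
  by (auto simp: indicator_def mem_dyadic_iff)

lemma integrable_indicator_dyadic [simp]:
  "integrable lborel (indicator (dyadic j k) :: real \<Rightarrow> real)"
  by (rule integrable_real_indicator) simp_all

lemma integrable_haar [simp]: "integrable lborel (haar (dyadic j k))"
  unfolding haar_dyadic [abs_def] by simp

lemma integral_haar [simp]: "integral\<^sup>L lborel (haar (dyadic j k)) = 0"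
  unfolding haar_dyadic [abs_def] by simp

lemma haar_constant_on_finer:
  assumes "j < j'" "x \<in> dyadic j k" "y \<in> dyadic j k"
  shows "haar (dyadic j' k') x = haar (dyadic j' k') y"
proof -
  have "dyadic_index (j' - 1) x = dyadic_index (j' - 1) y"
    using dyadic_index_coarser[of j "nat (j' - 1 - j)"] assms by (simp add: mem_dyadic_iff)
  then show ?thesis by (simp add: haar_eq_index dyadic_index_half[of j'])
qed

text \<open>An equality of functions is obtained, since it transfers both integrability and the
  vanishing integral from the finer Haar function to the product.\<close>

lemma haar_mult_finer:
  assumes "j < j'"
  obtains r where "(\<lambda>x. haar (dyadic j k) x * haar (dyadic j' k') x) = (\<lambda>x. haar (dyadic j k) x * r)"
proof -
  have "haar (dyadic j k) x * haar (dyadic j' k') x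
      = haar (dyadic j k) x * haar (dyadic j' k') (of_int k * 2 powi j)" for x
  proof (cases "x \<in> dyadic j k")
    case True
    moreover have "of_int k * 2 powi j \<in> dyadic j k" by (simp add: dyadic_def)
    ultimately show ?thesis by (metis haar_constant_on_finer[OF assms])
  qed (simp add: haar_def)
  then show thesis by (intro that ext)
qed

lemma haar_mult_same:
  "haar (dyadic j k) x * haar (dyadic j k') x
    = (if k = k' then indicator (dyadic j k) x / 2 powi j else 0)"
  by (auto simp: haar_eq_index indicator_def mem_dyadic_iff)

text \<open>At different scales the product is a multiple of the finer function and has mean zero.
  At equal scales the supports are disjoint, or the product is a normalized indicator.\<close>

lemma haar_orthonormal:
  "integrable lborel (\<lambda>x. haar (dyadic j k) x * haar (dyadic j' k') x)" (is ?A)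
  "(\<integral>x. haar (dyadic j k) x * haar (dyadic j' k') x \<partial>lborel)
     = (if dyadic j k = dyadic j' k' then 1 else 0)" (is ?B)
proof -
  have "?A \<and> ?B"
  proof (cases j j' rule: linorder_cases)
    case less
    obtain r where "(\<lambda>x. haar (dyadic j k) x * haar (dyadic j' k') x)
        = (\<lambda>x. haar (dyadic j k) x * r)"
      using haar_mult_finer[OF less] by blast
    then show ?thesis using less by (simp only:) simp
  next
    case greater
    obtain r where "(\<lambda>x. haar (dyadic j' k') x * haar (dyadic j k) x)
        = (\<lambda>x. haar (dyadic j' k') x * r)"
      using haar_mult_finer[OF greater] by blast
    then have "(\<lambda>x. haar (dyadic j k) x * haar (dyadic j' k') x)
        = (\<lambda>x. haar (dyadic j' k') x * r)"
      by (simp only: mult.commute)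
    then show ?thesis using greater by (simp only:) simp
  next
    case equal
    then show ?thesis by (simp add: haar_mult_same)
  qed
  then show ?A ?B by auto
qed

section \<open>Tensor Haar functions and the symbol\<close>

lemma integral_tensor:
  fixes u v :: "real \<Rightarrow> real"
  assumes u: "integrable lborel u" and v: "integrable lborel v"
  shows "integrable lborel (tensor u v)"
    and "integral\<^sup>L lborel (tensor u v) = integral\<^sup>L lborel u * integral\<^sup>L lborel v"
proof -
  have [measurable]: "u \<in> borel_measurable borel" "v \<in> borel_measurable borel"
    using u v by auto
  have *: "integrable (lborel \<Otimes>\<^sub>M lborel) (tensor u v)"
  proof (rule lborel_pair.Fubini_integrable)
    show "tensor u v \<in> borel_measurable (lborel \<Otimes>\<^sub>M lborel)"
      unfolding tensor_def by measurable
    show "integrable lborel (\<lambda>x. \<integral>y. norm (tensor u v (x, y)) \<partial>lborel)"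
      using u by (simp add: tensor_def abs_mult)
    show "AE x in lborel. integrable lborel (\<lambda>y. tensor u v (x, y))"
      using v by (simp add: tensor_def)
  qed
  then show "integrable lborel (tensor u v)" by (simp add: lborel_prod)
  show "integral\<^sup>L lborel (tensor u v) = integral\<^sup>L lborel u * integral\<^sup>L lborel v"
    using lborel_pair.integral_fst'[OF *] by (simp add: lborel_prod tensor_def)
qed

definition diagonal_rectangles :: "nat \<Rightarrow> (real set \<times> real set) set" where
  "diagonal_rectangles n =
     (\<lambda>(a, i, j). (dyadic (- int a) (int i), dyadic (- int a) (int j)))
       ` (SIGMA a:{..<n}. {..<2 ^ a} \<times> {..<2 ^ a})"

lemma sum_diagonal_rectangles:
  "(\<Sum>(I, J)\<in>diagonal_rectangles n. F I J) =
     (\<Sum>a<n. \<Sum>i<2 ^ a. \<Sum>j<2 ^ a. F (dyadic (- int a) (int i)) (dyadic (- int a) (int j)))"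
proof -
  have "inj_on (\<lambda>(a, i, j). (dyadic (- int a) (int i), dyadic (- int a) (int j)))
      (SIGMA a:{..<n}. {..<2 ^ a} \<times> {..<2 ^ a})"
    by (auto simp: inj_on_def)
  then have "(\<Sum>(I, J)\<in>diagonal_rectangles n. F I J) =
      (\<Sum>(a, i, j)\<in>(SIGMA a:{..<n}. {..<2 ^ a} \<times> {..<2 ^ a}).
         F (dyadic (- int a) (int i)) (dyadic (- int a) (int j)))"
    unfolding diagonal_rectangles_def by (simp add: sum.reindex case_prod_unfold)
  also have "\<dots> = (\<Sum>a<n. \<Sum>(i, j)\<in>{..<2 ^ a} \<times> {..<2 ^ a}.
         F (dyadic (- int a) (int i)) (dyadic (- int a) (int j)))"
    by (rule sum.Sigma[symmetric]) auto
  finally show ?thesis by (simp only: sum.cartesian_product)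
qed

lemma finite_diagonal_rectangles [simp]: "finite (diagonal_rectangles n)"
  by (simp add: diagonal_rectangles_def)

lemma diagonal_rectangles_subset:
  "diagonal_rectangles n \<subseteq> dyadic_intervals \<times> dyadic_intervals"
  by (auto simp: diagonal_rectangles_def)

text \<open>The function \<open>g\<close> of the opening. As \<open>I\<close> and \<open>J\<close>
  have equal length, each squared coefficient is \<open>n\<close> times the area of
  \<open>I \<times> J\<close>.\<close>

definition diagonal_symbol :: "nat \<Rightarrow> real \<times> real \<Rightarrow> real" where
  "diagonal_symbol n z =
     (\<Sum>(I, J)\<in>diagonal_rectangles n. sqrt n * measure lborel I * tensor (haar I) (haar J) z)"

lemma haar_coeff_diagonal_symbol:
  assumes "I \<in> dyadic_intervals" "J \<in> dyadic_intervals"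
  shows "haar_coeff (diagonal_symbol n) I J =
    (if (I, J) \<in> diagonal_rectangles n then sqrt n * measure lborel I else 0)"
proof -
  have tt: "integrable lborel (\<lambda>z. tensor (haar I') (haar J') z * tensor (haar I) (haar J) z)"
      "(\<integral>z. tensor (haar I') (haar J') z * tensor (haar I) (haar J) z \<partial>lborel)
       = (if (I', J') = (I, J) then 1 else 0)"
    if "(I', J') \<in> diagonal_rectangles n" for I' J'
  proof -
    have "I' \<in> dyadic_intervals" "J' \<in> dyadic_intervals"
      using that diagonal_rectangles_subset by auto
    then obtain j k j1 k1 j' k' j1' k1' where
      e: "I = dyadic j k" "J = dyadic j1 k1" "I' = dyadic j' k'" "J' = dyadic j1' k1'"
      using assms unfolding dyadic_intervals_eq by blast
    have *: "(\<lambda>z. tensor (haar I') (haar J') z * tensor (haar I) (haar J) z)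
       = tensor (\<lambda>x. haar I' x * haar I x) (\<lambda>y. haar J' y * haar J y)"
      by (auto simp: tensor_def)
    show "integrable lborel (\<lambda>z. tensor (haar I') (haar J') z * tensor (haar I) (haar J) z)"
      "(\<integral>z. tensor (haar I') (haar J') z * tensor (haar I) (haar J) z \<partial>lborel)
       = (if (I', J') = (I, J) then 1 else 0)"
      unfolding * unfolding e
      by (auto simp: integral_tensor haar_orthonormal simp del: dyadic_eq_iff)
  qed
  have "haar_coeff (diagonal_symbol n) I J =
     (\<integral>z. (\<Sum>(I', J')\<in>diagonal_rectangles n. sqrt n * measure lborel I' *
        (tensor (haar I') (haar J') z * tensor (haar I) (haar J) z)) \<partial>lborel)"
    unfolding haar_coeff_def diagonal_symbol_def
    by (simp add: sum_distrib_right case_prod_unfold mult.assoc)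
  also have "\<dots> = (\<Sum>R\<in>diagonal_rectangles n. sqrt n * measure lborel (fst R) *
      (\<integral>z. tensor (haar (fst R)) (haar (snd R)) z * tensor (haar I) (haar J) z \<partial>lborel))"
    by (subst Bochner_Integration.integral_sum) (auto simp: tt case_prod_unfold)
  also have "\<dots> = (\<Sum>R\<in>diagonal_rectangles n.
      sqrt n * measure lborel (fst R) * (if R = (I, J) then 1 else 0))"
    by (intro sum.cong refl) (simp only: tt prod.collapse)
  also have "\<dots> = (\<Sum>R\<in>diagonal_rectangles n.
      if (I, J) = R then sqrt n * measure lborel (fst R) else 0)"
    by (intro sum.cong) auto
  also have "\<dots> = (if (I, J) \<in> diagonal_rectangles n then sqrt n * measure lborel I else 0)"
    by (subst sum.delta') auto
  finally show ?thesis .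
qed

lemma haar_support_diagonal_symbol:
  assumes "0 < n"
  shows "haar_support (diagonal_symbol n) = diagonal_rectangles n"
proof -
  have "measure lborel I \<noteq> 0" if "I \<in> dyadic_intervals" for I
    using that by (auto simp: dyadic_intervals_eq)
  then show ?thesis
    using assms diagonal_rectangles_subset[of n]
    by (auto simp: haar_support_def haar_coeff_diagonal_symbol split: if_splits)
qed

lemma finite_haar_support_diagonal_symbol:
  assumes "0 < n"
  shows "finite_haar_support (diagonal_symbol n)"
proof -
  have "diagonal_symbol n z = (\<Sum>(I, J)\<in>diagonal_rectangles n.
      haar_coeff (diagonal_symbol n) I J * tensor (haar I) (haar J) z)" for z
    unfolding diagonal_symbol_def[of n z]
    using diagonal_rectangles_subset[of n]
    by (intro sum.cong) (auto simp: haar_coeff_diagonal_symbol)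
  then show ?thesis
    unfolding finite_haar_support_def haar_support_diagonal_symbol[OF assms] by auto
qed

section \<open>The BMO norm of the symbol\<close>

definition square :: "nat \<Rightarrow> nat \<Rightarrow> nat \<Rightarrow> (real \<times> real) set" where
  "square m i j = dyadic (- int m) (int i) \<times> dyadic (- int m) (int j)"

lemma square_measurable [measurable, simp]: "square m i j \<in> sets borel"
  unfolding square_def borel_prod[symmetric] by (intro pair_measureI) auto

lemma powi_minus_squared: "(2::real) powi - int m * 2 powi - int m = 1 / 4 ^ m"
proof -
  have "(4::real) ^ m = 2 ^ m * 2 ^ m" by (simp flip: power_mult_distrib)
  then show ?thesis by (simp add: power_int_minus field_simps)
qed

lemma emeasure_square [simp]: "emeasure lborel (square m i j) = ennreal (1 / 4 ^ m)"
  unfolding square_def lborel_prod[symmetric]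
  by (subst lborel.emeasure_pair_measure_Times)
    (simp_all add: powi_minus_squared flip: ennreal_mult)

lemma disjoint_squares: "disjoint_family_on (\<lambda>(i, j). square m i j) X"
  by (auto simp: disjoint_family_on_def square_def mem_dyadic_iff)

lemma sum_squares_le_emeasure:
  assumes "finite X" "\<Omega> \<in> sets borel" "\<And>i j. (i, j) \<in> X \<Longrightarrow> square m i j \<subseteq> \<Omega>"
  shows "(\<Sum>(i, j)\<in>X. ennreal (1 / 4 ^ m)) \<le> emeasure lborel \<Omega>"
proof -
  have "(\<Sum>(i, j)\<in>X. ennreal (1 / 4 ^ m)) = (\<Sum>q\<in>X. emeasure lborel (case q of (i, j) \<Rightarrow> square m i j))"
    by (intro sum.cong) auto
  also have "\<dots> = emeasure lborel (\<Union>q\<in>X. case q of (i, j) \<Rightarrow> square m i j)"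
    using assms(1) by (intro sum_emeasure disjoint_squares) auto
  also have "\<dots> \<le> emeasure lborel \<Omega>"
    using assms by (intro emeasure_mono) auto
  finally show ?thesis .
qed

lemma enn_powr_mono:
  assumes "x \<le> y" "0 \<le> a"
  shows "enn_powr x a \<le> enn_powr y a"
proof (cases "y = top")
  case False
  then have "x \<noteq> top" using assms(1) by (auto simp: top_unique)
  then show ?thesis
    using False assms unfolding enn_powr_def
    by (auto intro!: ennreal_leI powr_mono2 enn2real_mono simp: less_top)
qed (simp add: enn_powr_def)

lemma enn_powr_ennreal: "0 \<le> r \<Longrightarrow> enn_powr (ennreal r) a = ennreal (r powr a)"
  by (simp add: enn_powr_def)

text \<open>Coefficients off the diagonal squares vanish, so the infinite sum is finite and can be
  sorted by generation.\<close>

lemma haar_energy_diagonal_symbol: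
  "(\<Sum>\<^sub>\<infinity>(I, J)\<in>{(I, J). I \<in> dyadic_intervals \<and> J \<in> dyadic_intervals \<and> I \<times> J \<subseteq> \<Omega>}.
      ennreal ((haar_coeff (diagonal_symbol n) I J)\<^sup>2))
   = (\<Sum>a<n. \<Sum>(i, j)\<in>{(i, j) \<in> {..<2 ^ a} \<times> {..<2 ^ a}. square a i j \<subseteq> \<Omega>}.
        ennreal n * ennreal (1 / 4 ^ a))"
proof -
  let ?D = "{(I, J). I \<in> dyadic_intervals \<and> J \<in> dyadic_intervals \<and> I \<times> J \<subseteq> \<Omega>}"
  let ?c = "\<lambda>I J. ennreal ((haar_coeff (diagonal_symbol n) I J)\<^sup>2)"
  let ?e = "\<lambda>I J. if I \<times> J \<subseteq> \<Omega> then ennreal ((sqrt n * measure lborel I)\<^sup>2) else 0"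
  have "(\<Sum>\<^sub>\<infinity>(I, J)\<in>?D. ?c I J) = (\<Sum>\<^sub>\<infinity>(I, J)\<in>diagonal_rectangles n. ?e I J)"
    using diagonal_rectangles_subset[of n]
    by (intro infsum_cong_neutral) (auto simp: haar_coeff_diagonal_symbol split: if_splits)
  also have "\<dots> = (\<Sum>(I, J)\<in>diagonal_rectangles n. ?e I J)"
    by simp
  also have "\<dots> = (\<Sum>a<n. \<Sum>(i, j)\<in>{..<2 ^ a} \<times> {..<2 ^ a}.
      if square a i j \<subseteq> \<Omega> then ennreal n * ennreal (1 / 4 ^ a) else 0)"
    unfolding sum_diagonal_rectangles sum.cartesian_product
    by (intro sum.cong refl)
      (auto simp: square_def power_mult_distrib powi_minus_squared power2_eq_square[of "2 powi _"]
        simp flip: ennreal_mult)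
  also have "\<dots> = (\<Sum>a<n. \<Sum>(i, j)\<in>{(i, j) \<in> {..<2 ^ a} \<times> {..<2 ^ a}. square a i j \<subseteq> \<Omega>}.
        ennreal n * ennreal (1 / 4 ^ a))"
    by (rule sum.cong[OF refl], rule sum.mono_neutral_cong_right)
      (auto split: if_splits)
  finally show ?thesis .
qed

text \<open>The squares of one generation inside \<open>\<Omega>\<close> are disjoint and contribute
  at most \<open>n\<close> times its measure, so \<open>n\<close> generations give at most
  \<open>n * n\<close> times it. For open sets shrinking to the unit square this is attained in the
  limit.\<close>

lemma product_bmo_norm_diagonal_symbol:
  assumes "0 < n"
  shows "product_bmo_norm (diagonal_symbol n) = ennreal n"
proof -
  define E where "E \<Omega> = (\<Sum>a<n. \<Sum>(i, j)\<in>{(i, j) \<in> {..<2 ^ a} \<times> {..<2 ^ a}. square a i j \<subseteq> \<Omega>}.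
        ennreal n * ennreal (1 / 4 ^ a))" for \<Omega>
  define W :: "(real \<times> real) set set" where
    "W = {\<Omega>. open \<Omega> \<and> 0 < emeasure lborel \<Omega> \<and> emeasure lborel \<Omega> < top}"
  define B where "B = product_bmo_norm (diagonal_symbol n)"
  have B: "B = (SUP \<Omega>\<in>W. enn_powr (E \<Omega> / emeasure lborel \<Omega>) (1 / 2))"
    unfolding B_def product_bmo_norm_def haar_energy_diagonal_symbol W_def E_def ..
  have half: "(real n * real n) powr (1 / 2) = n"
    by (simp add: powr_half_sqrt)
  have upper: "B \<le> ennreal n"
    unfolding B
  proof (rule SUP_least)
    fix \<Omega> assume W: "\<Omega> \<in> W"
    have "E \<Omega> \<le> (\<Sum>a<n. ennreal n * emeasure lborel \<Omega>)"
      unfolding E_def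
    proof (rule sum_mono)
      fix a
      let ?X = "{(i, j) \<in> {..<2 ^ a} \<times> {..<2 ^ a}. square a i j \<subseteq> \<Omega>}"
      have "finite ?X" by (rule finite_subset[of _ "{..<2 ^ a} \<times> {..<2 ^ a}"]) auto
      then have "(\<Sum>(i, j)\<in>?X. ennreal (1 / 4 ^ a)) \<le> emeasure lborel \<Omega>"
        using W by (intro sum_squares_le_emeasure) (auto simp: W_def)
      then have "ennreal n * (\<Sum>(i, j)\<in>?X. ennreal (1 / 4 ^ a)) \<le> ennreal n * emeasure lborel \<Omega>"
        by (rule mult_left_mono) simp
      then show "(\<Sum>(i, j)\<in>?X. ennreal n * ennreal (1 / 4 ^ a)) \<le> ennreal n * emeasure lborel \<Omega>"
        by (simp only: sum_distrib_left case_prod_unfold)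
    qed
    also have "\<dots> = emeasure lborel \<Omega> * ennreal (real n * real n)"
      by (simp add: ennreal_mult ennreal_of_nat_eq_real_of_nat mult_ac)
    finally have "E \<Omega> / emeasure lborel \<Omega> \<le> ennreal (real n * real n)"
      using W by (intro divide_le_posI_ennreal) (auto simp: W_def)
    then have "enn_powr (E \<Omega> / emeasure lborel \<Omega>) (1 / 2)
        \<le> enn_powr (ennreal (real n * real n)) (1 / 2)"
      by (rule enn_powr_mono) simp
    also have "\<dots> = ennreal n"
      by (subst enn_powr_ennreal) (simp_all only: half, simp)
    finally show "enn_powr (E \<Omega> / emeasure lborel \<Omega>) (1 / 2) \<le> ennreal n" .
  qed
  define b where "b = enn2real B"
  have b: "B = ennreal b"
    using upper by (auto simp: b_def top_unique intro!: ennreal_enn2real[symmetric] simp: less_top[symmetric])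
  have "real n \<le> b"
  \<comment> \<open>The half-open unit square is not open, so it is enclosed in an open square of
    side \<open>1 / t\<close>; this costs the factor \<open>t\<close>, which is arbitrarily close to
    1.\<close>
  proof (rule field_le_mult_one_interval)
    fix t :: real assume t: "0 < t" "t < 1"
    define \<Omega> where "\<Omega> = {1 - 1 / t<..<1} \<times> {1 - 1 / t<..<(1 :: real)}"
    have op: "open \<Omega>" by (simp add: \<Omega>_def open_Times)
    have "1 - 1 / t \<le> 1" using t by simp
    then have em: "emeasure lborel \<Omega> = ennreal (1 / (t * t))"
      using t unfolding \<Omega>_def lborel_prod[symmetric]
      by (subst lborel.emeasure_pair_measure_Times) (simp_all flip: ennreal_mult)
    have sub: "square a i j \<subseteq> \<Omega>" if "i < 2 ^ a" "j < 2 ^ a" for a i j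
    proof -
      have "dyadic (- int a) (int i) \<subseteq> {1 - 1 / t<..<1}" if "i < 2 ^ a" for i
      proof
        fix x assume "x \<in> dyadic (- int a) (int i)"
        then have "real i / 2 ^ a \<le> x" "x < (real i + 1) / 2 ^ a"
          by (auto simp: dyadic_def power_int_minus field_simps)
        moreover have "real i + 1 \<le> 2 ^ a"
          using that by (metis Suc_leI add.commute of_nat_Suc of_nat_le_iff of_nat_numeral of_nat_power)
        then have "(real i + 1) / 2 ^ a \<le> 1" by (simp add: field_simps)
        moreover have "0 \<le> real i / 2 ^ a" by simp
        moreover have "1 - 1 / t < 0" using t by (simp add: field_simps)
        ultimately show "x \<in> {1 - 1 / t<..<1}"
          by (simp only: greaterThanLessThan_iff) linarith
      qed
      then show ?thesis using that by (auto simp: square_def \<Omega>_def)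
    qed
    have "{(i, j) \<in> {..<2 ^ a} \<times> {..<2 ^ a}. square a i j \<subseteq> \<Omega>} = {..<2 ^ a} \<times> {..<2 ^ a}" for a
      using sub by auto
    then have "E \<Omega> = (\<Sum>a<n. \<Sum>(i, j)\<in>{..<2 ^ a :: nat} \<times> {..<2 ^ a :: nat}.
        ennreal n * ennreal (1 / 4 ^ a))"
      by (simp only: E_def)
    also have "\<dots> = (\<Sum>a<n. ennreal n)"
    proof (rule sum.cong)
      fix a
      have "(\<Sum>(i, j)\<in>{..<2 ^ a :: nat} \<times> {..<2 ^ a :: nat}. ennreal n * ennreal (1 / 4 ^ a))
          = of_nat (2 ^ a * 2 ^ a) * (ennreal n * ennreal (1 / 4 ^ a))"
        by simp
      also have "(2 ^ a * 2 ^ a :: nat) = 4 ^ a" by (simp flip: power_mult_distrib)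
      also have "of_nat (4 ^ a) * (ennreal n * ennreal (1 / 4 ^ a)) = ennreal (4 ^ a * (n * (1 / 4 ^ a)))"
        by (subst ennreal_mult, simp, simp, subst ennreal_mult) (simp_all add: ennreal_of_nat_eq_real_of_nat)
      finally show "(\<Sum>(i, j)\<in>{..<2 ^ a :: nat} \<times> {..<2 ^ a :: nat}. ennreal n * ennreal (1 / 4 ^ a))
          = ennreal n" by simp
    qed simp
    also have "\<dots> = ennreal (real n * real n)"
      by (simp add: ennreal_mult ennreal_of_nat_eq_real_of_nat)
    finally have E: "E \<Omega> = ennreal (real n * real n)" .
    have "E \<Omega> / emeasure lborel \<Omega> = ennreal ((t * n) * (t * n))"
      unfolding E em using t by (subst divide_ennreal) (auto simp: mult_ac)
    then have "enn_powr (E \<Omega> / emeasure lborel \<Omega>) (1 / 2) = ennreal (((t * n) * (t * n)) powr (1 / 2))"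
      by (simp add: enn_powr_ennreal)
    also have "((t * n) * (t * n)) powr (1 / 2) = t * n"
      using t by (simp add: powr_half_sqrt)
    finally have "ennreal (t * n) \<le> B"
      unfolding B using op em t by (intro SUP_upper2[of \<Omega>]) (auto simp: W_def)
    then show "t * n \<le> b"
      unfolding b by (simp add: b_def)
  qed
  then have "ennreal n \<le> B" unfolding b by (rule ennreal_leI)
  with upper show ?thesis unfolding B_def by (rule antisym)
qed

section \<open>The operator norm\<close>

lemma indicator_dyadic_half:
  "indicator (dyadic j k) x = (indicator (dyadic (j - 1) (2 * k)) x
     + indicator (dyadic (j - 1) (2 * k + 1)) x :: real)"
  by (auto simp: indicator_def mem_dyadic_iff dyadic_index_half[of j])

lemma minus_int_Suc: "- int m - 1 = - int (Suc m)"
  by simp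

lemma indicator_square:
  "indicator (square m i j) (x, y)
     = (indicator (dyadic (- int m) (int i)) x * indicator (dyadic (- int m) (int j)) y :: real)"
  by (simp add: square_def indicator_times)

lemma indicator_square_split:
  "indicator (square m i j) z = (indicator (square (Suc m) (2 * i) (2 * j)) z
     + indicator (square (Suc m) (2 * i) (2 * j + 1)) z
     + indicator (square (Suc m) (2 * i + 1) (2 * j)) z
     + indicator (square (Suc m) (2 * i + 1) (2 * j + 1)) z :: real)"
  by (cases z) (simp only: indicator_square indicator_dyadic_half[of "- int m"] minus_int_Suc
      of_nat_add of_nat_mult of_nat_numeral of_nat_1 distrib_left distrib_right add_ac)

definition square_average :: "(real \<times> real \<Rightarrow> real) \<Rightarrow> nat \<Rightarrow> nat \<Rightarrow> nat \<Rightarrow> real" where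
  "square_average f m i j = 4 ^ m * (\<integral>z. indicator (square m i j) z * f z \<partial>lborel)"

text \<open>Integrability over each dyadic square, not square-integrability in the sense of
  \<open>L^2\<close>. It makes all averages additive under splitting a square.\<close>

definition square_integrable :: "(real \<times> real \<Rightarrow> real) \<Rightarrow> bool" where
  "square_integrable f \<longleftrightarrow> (\<forall>m i j. integrable lborel (\<lambda>z. indicator (square m i j) z * f z))"

lemma square_average_split:
  assumes "square_integrable f"
  shows "square_average f m i j =
     (square_average f (Suc m) (2 * i) (2 * j) + square_average f (Suc m) (2 * i) (2 * j + 1)
       + square_average f (Suc m) (2 * i + 1) (2 * j)
       + square_average f (Suc m) (2 * i + 1) (2 * j + 1)) / 4"
proof -
  have i: "integrable lborel (\<lambda>z. indicator (square m i j) z * f z)" for m i j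
    using assms by (simp add: square_integrable_def)
  show ?thesis
    unfolding square_average_def indicator_square_split[of m i j] distrib_right
    by (simp add: i Bochner_Integration.integral_add Bochner_Integration.integrable_add
        del: One_nat_def) (simp add: algebra_simps)
qed

text \<open>On the four children of \<open>I \<times> J\<close> the function
  \<open>\<chi>\<^sub>I \<otimes> h\<^sub>J\<close> is constant with signs given by the
  \<open>y\<close>-half, so integrating \<open>f\<close> against it gives a multiple of
  \<open>ydiff\<close>.\<close>

lemma average_partial_haar_coeff:
  assumes f: "square_integrable f"
  shows "average (dyadic (- int a) (int i)) (partial_haar_coeff f (dyadic (- int a) (int j)))
    * sqrt (2 powi (- int a)) = 2 powi (- int a) * ydiff (square_average f) a i j"
proof -
  let ?I = "dyadic (- int a) (int i)" and ?J = "dyadic (- int a) (int j)"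
  define s where "s = sqrt (2 powi (- int a) :: real)"
  have s: "0 < s" "s * s = 2 powi (- int a)" by (simp_all add: s_def)
  define P where "P i j = (\<integral>z. indicator (square (Suc a) i j) z * f z \<partial>lborel)" for i j
  have int: "integrable lborel (\<lambda>z. indicator (square m i j) z * f z)" for m i j
    using f by (simp add: square_integrable_def)
  have split: "indicator ?I x * (f (x, y) * haar ?J y) =
      (indicator (square (Suc a) (2 * i) (2 * j)) (x, y) * f (x, y)
       + indicator (square (Suc a) (2 * i + 1) (2 * j)) (x, y) * f (x, y)
       - indicator (square (Suc a) (2 * i) (2 * j + 1)) (x, y) * f (x, y)
       - indicator (square (Suc a) (2 * i + 1) (2 * j + 1)) (x, y) * f (x, y)) / s" for x y
    unfolding indicator_square haar_dyadic indicator_dyadic_half[of "- int a"] minus_int_Suc s_def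
    by (simp add: field_simps del: One_nat_def)
  have *: "integrable (lborel \<Otimes>\<^sub>M lborel) (\<lambda>(x, y). indicator ?I x * (f (x, y) * haar ?J y))"
    unfolding split lborel_prod case_prod_unfold prod.collapse
    by (intro Bochner_Integration.integrable_divide_zero Bochner_Integration.integrable_diff
        Bochner_Integration.integrable_add int)
  have "(LINT x:?I|lborel. partial_haar_coeff f ?J x)
      = (\<integral>x. (\<integral>y. indicator ?I x * (f (x, y) * haar ?J y) \<partial>lborel) \<partial>lborel)"
    by (simp add: set_lebesgue_integral_def partial_haar_coeff_def)
  also have "\<dots> = (\<integral>z. (case z of (x, y) \<Rightarrow> indicator ?I x * (f (x, y) * haar ?J y)) \<partial>lborel)"
    using lborel_pair.integral_fst'[OF *] by (simp add: lborel_prod)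
  also have "\<dots> = (P (2 * i) (2 * j) + P (2 * i + 1) (2 * j)
      - P (2 * i) (2 * j + 1) - P (2 * i + 1) (2 * j + 1)) / s"
    unfolding split case_prod_unfold prod.collapse P_def
    by (simp only: Bochner_Integration.integral_divide_zero Bochner_Integration.integral_diff
        Bochner_Integration.integral_add Bochner_Integration.integrable_diff
        Bochner_Integration.integrable_add int)
  also have "\<dots> = ydiff (square_average f) a i j / (4 ^ a * s)"
  proof -
    have "ydiff (square_average f) a i j = 4 ^ a * (P (2 * i) (2 * j) + P (2 * i + 1) (2 * j)
      - P (2 * i) (2 * j + 1) - P (2 * i + 1) (2 * j + 1))"
      unfolding ydiff_def square_average_def P_def[symmetric] by (simp add: field_simps)
    then show ?thesis by simp
  qed
  \<comment> \<open>With \<open>s * s\<close> the side length, the area \<open>1 / 4 ^ a\<close> is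
    the fourth power of \<open>s\<close>; all powers of \<open>s\<close> can then be
    cancelled.\<close>
  finally have "(LINT x:?I|lborel. partial_haar_coeff f ?J x)
      = ydiff (square_average f) a i j * ((s * s) * (s * s)) / s"
    unfolding s(2) powi_minus_squared by simp
  then show ?thesis
    using s(1) unfolding average_def measure_dyadic s_def[symmetric] s(2)[symmetric] by simp
qed

text \<open>The sum of \<open>r\<^sub>a(x) D\<^sub>a f\<close> from the opening: the parity of the
  index one generation further down is the Rademacher sign \<open>r\<^sub>a\<close>.\<close>

definition shift_sum :: "(nat \<Rightarrow> nat \<Rightarrow> nat \<Rightarrow> real) \<Rightarrow> nat \<Rightarrow> real \<times> real \<Rightarrow> real" where
  "shift_sum u n z = (\<Sum>a<n. \<Sum>i<2 ^ a. \<Sum>j<2 ^ a. ydiff u a i j *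
     (indicator (dyadic (- int a) (int i)) (fst z) *
      (if even (dyadic_index (- int (Suc a)) (fst z)) then 1 else - 1) *
      indicator (dyadic (- int a) (int j)) (snd z)))"

text \<open>With \<open>s * s\<close> the side length, the average contributes \<open>s\<close>, the
  coefficient of the symbol \<open>s * s\<close>, the Haar function \<open>1 / s\<close> and the
  normalized indicator \<open>1 / (s * s)\<close>. These powers cancel, leaving
  \<open>sqrt n\<close>.\<close>

lemma pi4_diagonal_symbol:
  assumes "0 < n" and f: "square_integrable f"
  shows "pi4 (diagonal_symbol n) f z = sqrt n * shift_sum (square_average f) n z"
proof -
  obtain x y where z: "z = (x, y)" by fastforce
  have summand: "average (dyadic (- int a) (int i)) (partial_haar_coeff f (dyadic (- int a) (int j)))
       * (sqrt n * measure lborel (dyadic (- int a) (int i)))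
       * tensor (haar (dyadic (- int a) (int i))) (chi_bar (dyadic (- int a) (int j))) z
     = sqrt n * (ydiff (square_average f) a i j *
     (indicator (dyadic (- int a) (int i)) (fst z) *
      (if even (dyadic_index (- int (Suc a)) (fst z)) then 1 else - 1) *
      indicator (dyadic (- int a) (int j)) (snd z)))" for a i j
  proof -
    define s where "s = sqrt (2 powi (- int a) :: real)"
    have s: "0 < s" "s * s = 2 powi (- int a)" by (simp_all add: s_def)
    define A where "A = average (dyadic (- int a) (int i)) (partial_haar_coeff f (dyadic (- int a) (int j)))"
    define D where "D = ydiff (square_average f) a i j"
    define e :: real where "e = (if even (dyadic_index (- int (Suc a)) x) then 1 else - 1)"
    have "A * s = s * s * D"
      using average_partial_haar_coeff[OF f, of a i j] by (simp only: A_def D_def s_def[symmetric] s)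
    then have "A * s = (s * D) * s" by (simp only: mult_ac)
    then have A: "A = s * D" using s(1) by (simp only: mult_cancel_right) simp
    have h: "haar (dyadic (- int a) (int i)) x = indicator (dyadic (- int a) (int i)) x * e / s"
      unfolding haar_eq_index minus_int_Suc by (auto simp: indicator_def mem_dyadic_iff e_def s_def)
    have c: "chi_bar (dyadic (- int a) (int j)) y = indicator (dyadic (- int a) (int j)) y / (s * s)"
      by (simp add: chi_bar_def s)
    show ?thesis
      unfolding z fst_conv snd_conv tensor_def prod.case h c A_def[symmetric] D_def[symmetric] A
        e_def[symmetric] measure_dyadic s(2)[symmetric]
      using s(1) by (simp add: field_simps)
  qed
  have "pi4 (diagonal_symbol n) f z = (\<Sum>(I, J)\<in>diagonal_rectangles n.
      average I (partial_haar_coeff f J) * (sqrt n * measure lborel I) * tensor (haar I) (chi_bar J) z)"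
    unfolding pi4_def haar_support_diagonal_symbol[OF assms(1)]
    using diagonal_rectangles_subset[of n]
    by (intro sum.cong refl) (auto simp: haar_coeff_diagonal_symbol)
  also have "\<dots> = sqrt n * shift_sum (square_average f) n z"
    unfolding sum_diagonal_rectangles summand shift_sum_def by (simp only: sum_distrib_left)
  finally show ?thesis .
qed

section \<open>Pointwise values on the unit square\<close>

lemma dyadic_index_unit:
  assumes "0 \<le> x" "x < 1"
  shows "0 \<le> dyadic_index (- int m) x" "nat (dyadic_index (- int m) x) < 2 ^ m"
proof -
  have e: "dyadic_index (- int m) x = \<lfloor>x * 2 ^ m\<rfloor>"
    by (simp add: dyadic_index_def power_int_minus field_simps)
  have "x * 2 ^ m < 1 * 2 ^ m" using assms by (intro mult_strict_right_mono) auto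
  then have "\<lfloor>x * 2 ^ m\<rfloor> < 2 ^ m" by (simp add: floor_less_iff)
  moreover show "0 \<le> dyadic_index (- int m) x" using assms by (simp add: e)
  ultimately show "nat (dyadic_index (- int m) x) < 2 ^ m" by (simp add: e nat_less_iff)
qed

lemma mem_dyadic_unit:
  assumes "x \<in> dyadic (- int m) (int i)" "i < 2 ^ m"
  shows "0 \<le> x" "x < 1"
proof -
  have "real i / 2 ^ m \<le> x" "x < (real i + 1) / 2 ^ m"
    using assms(1) by (auto simp: dyadic_def power_int_minus field_simps)
  moreover have "real i + 1 \<le> 2 ^ m"
    using assms(2) by (metis Suc_leI add.commute of_nat_Suc of_nat_le_iff of_nat_numeral of_nat_power)
  then have "(real i + 1) / 2 ^ m \<le> 1" by (simp add: field_simps)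
  moreover have "0 \<le> real i / 2 ^ m" by simp
  ultimately show "0 \<le> x" "x < 1" by linarith+
qed

lemma sum_dyadic_unit:
  assumes "0 \<le> x" "x < 1"
  shows "(\<Sum>i<2 ^ m. F i * indicator (dyadic (- int m) (int i)) x)
     = (F (nat (dyadic_index (- int m) x)) :: real)"
proof -
  have "(\<Sum>i<2 ^ m. F i * indicator (dyadic (- int m) (int i)) x)
      = (\<Sum>i<2 ^ m. if i = nat (dyadic_index (- int m) x) then F i else 0)"
    using dyadic_index_unit[OF assms, of m]
    by (intro sum.cong refl) (auto simp: indicator_def mem_dyadic_iff)
  then show ?thesis using dyadic_index_unit[OF assms, of m] by simp
qed

text \<open>Links the operator to the tree: exactly one square of each generation contains the
  point, so each generation adds one increment, and halving indices recovers the parent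
  square.\<close>

lemma shift_sum_unit:
  assumes "0 \<le> x" "x < 1" "0 \<le> y" "y < 1"
  shows "shift_sum u n (x, y)
     = shifted u n (nat (dyadic_index (- int n) x)) (nat (dyadic_index (- int n) y))"
proof (induction n)
  case 0
  then show ?case by (simp add: shift_sum_def)
next
  case (Suc n)
  define k l where "k = nat (dyadic_index (- int n) x)" and "l = nat (dyadic_index (- int n) y)"
  define k' l' where "k' = nat (dyadic_index (- int (Suc n)) x)"
    and "l' = nat (dyadic_index (- int (Suc n)) y)"
  have half: "nat (dyadic_index (- int (Suc n)) w) div 2 = nat (dyadic_index (- int n) w)"
    if "0 \<le> w" "w < 1" for w
    using dyadic_index_half[of "- int n" w] dyadic_index_unit(1)[OF that, of "Suc n"]
    unfolding minus_int_Suc by (simp add: nat_div_distrib)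
  have k: "k' div 2 = k" "l' div 2 = l"
    unfolding k_def l_def k'_def l'_def using assms by (simp_all only: half)
  have sg: "(if even (dyadic_index (- int (Suc n)) x) then 1 else - 1) = half_sign k'"
    unfolding half_sign_def k'_def using dyadic_index_unit(1)[OF assms(1,2), of "Suc n"]
    by (simp only: even_nat_iff)
  have "shift_sum u (Suc n) (x, y) = shift_sum u n (x, y) +
     (\<Sum>i<2 ^ n. (\<Sum>j<2 ^ n. (ydiff u n i j * half_sign k') * indicator (dyadic (- int n) (int j)) y)
        * indicator (dyadic (- int n) (int i)) x)"
    unfolding shift_sum_def sum.lessThan_Suc fst_conv snd_conv sg
    by (simp only: sum_distrib_left sum_distrib_right mult_ac)
  also have "\<dots> = shift_sum u n (x, y) + ydiff u n k l * half_sign k'"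
    using assms by (simp only: sum_dyadic_unit k_def l_def)
  finally show ?case
    unfolding Suc.IH k_def[symmetric] l_def[symmetric] k'_def[symmetric] l'_def[symmetric]
    by (simp add: k mult.commute)
qed

lemma shift_sum_outside:
  assumes "\<not> (0 \<le> x \<and> x < 1 \<and> 0 \<le> y \<and> y < 1)"
  shows "shift_sum u n (x, y) = 0"
proof -
  have "indicator (dyadic (- int a) (int i)) x * indicator (dyadic (- int a) (int j)) y = (0::real)"
    if "i < 2 ^ a" "j < 2 ^ a" for a i j
    using mem_dyadic_unit[of x a i] mem_dyadic_unit[of y a j] that assms by (auto simp: indicator_def)
  then show ?thesis unfolding shift_sum_def by (intro sum.neutral ballI) auto
qed

lemma sum_indicator_squares:
  fixes c :: "nat \<Rightarrow> nat \<Rightarrow> real"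
  shows "(\<Sum>i<2 ^ n. \<Sum>j<2 ^ n. c i j * indicator (square n i j) (x, y)) =
    (if 0 \<le> x \<and> x < 1 \<and> 0 \<le> y \<and> y < 1
     then c (nat (dyadic_index (- int n) x)) (nat (dyadic_index (- int n) y)) else 0)"
proof (cases "0 \<le> x \<and> x < 1 \<and> 0 \<le> y \<and> y < 1")
  case True
  have "(\<Sum>i<2 ^ n. \<Sum>j<2 ^ n. c i j * indicator (square n i j) (x, y)) =
     (\<Sum>i<2 ^ n. (\<Sum>j<2 ^ n. c i j * indicator (dyadic (- int n) (int j)) y)
        * indicator (dyadic (- int n) (int i)) x)"
    by (simp only: indicator_square sum_distrib_left sum_distrib_right mult_ac)
  then show ?thesis using True by (simp only: sum_dyadic_unit if_True simp_thms)
next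
  case False
  have "indicator (square n i j) (x, y) = (0::real)" if "i < 2 ^ n" "j < 2 ^ n" for i j
    using mem_dyadic_unit[of x n i] mem_dyadic_unit[of y n j] that False
    by (auto simp: indicator_def square_def)
  then show ?thesis using False by (auto intro!: sum.neutral)
qed

text \<open>\<open>shift_sum u n\<close> is a step function on the disjoint squares of generation
  \<open>n\<close>, so the power can be taken on each square separately.\<close>

lemma abs_shift_sum_powr:
  "\<bar>shift_sum u n z\<bar> powr p
     = (\<Sum>i<2 ^ n. \<Sum>j<2 ^ n. \<bar>shifted u n i j\<bar> powr p * indicator (square n i j) z)"
  by (cases z, simp only: sum_indicator_squares) (simp add: shift_sum_unit shift_sum_outside)

section \<open>Passage from sums over squares to \<open>L^p\<close> norms\<close>

lemma enn_powr_eq_top_iff: "enn_powr x a = top \<longleftrightarrow> x = top"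
  by (simp add: enn_powr_def)

lemma Lp_powr_integrable:
  assumes "f \<in> Lp p"
  shows "integrable lborel (\<lambda>z. \<bar>f z\<bar> powr p)"
proof -
  have [measurable]: "f \<in> borel_measurable borel" using assms by (auto simp: Lp_def)
  have "(\<integral>\<^sup>+z. ennreal (\<bar>f z\<bar> powr p) \<partial>lborel) < top"
    using assms by (auto simp: Lp_def Lp_norm_def enn_powr_eq_top_iff less_top[symmetric])
  then show ?thesis by (intro integrableI_nonneg) auto
qed

text \<open>On a square of finite measure
  \<open>\<bar>t\<bar> \<le> 1 + \<bar>t\<bar> powr p\<close> supplies an integrable
  majorant.\<close>

lemma Lp_square_integrable:
  assumes "1 < p" and f: "f \<in> Lp p"
  shows "square_integrable f"
  unfolding square_integrable_def
proof (intro allI)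
  fix m i j
  have [measurable]: "f \<in> borel_measurable borel" using f by (auto simp: Lp_def)
  have 1: "integrable lborel (\<lambda>z. indicator (square m i j) z + \<bar>f z\<bar> powr p)"
    by (intro Bochner_Integration.integrable_add Lp_powr_integrable[OF f] integrable_real_indicator) auto
  show "integrable lborel (\<lambda>z. indicator (square m i j) z * f z)"
  proof (rule Bochner_Integration.integrable_bound[OF 1])
    have le: "\<bar>t\<bar> \<le> 1 + \<bar>t\<bar> powr p" for t :: real
    proof (cases "\<bar>t\<bar> \<le> 1")
      case False
      then have "\<bar>t\<bar> powr 1 \<le> \<bar>t\<bar> powr p" using assms(1) by (intro powr_mono) auto
      then show ?thesis by simp
    qed (simp add: add_increasing2)
    show "AE z in lborel. norm (indicator (square m i j) z * f z)
        \<le> norm (indicator (square m i j) z + \<bar>f z\<bar> powr p)"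
      using le by (auto simp: indicator_def)
  qed measurable
qed

text \<open>Jensen's inequality: the supporting line at the average \<open>u\<close> is integrated
  over the square, where its linear term has integral zero.\<close>

lemma square_average_powr_le:
  assumes p: "1 < p" and f: "f \<in> Lp p"
  shows "\<bar>square_average f m i j\<bar> powr p
    \<le> 4 ^ m * (\<integral>z. indicator (square m i j) z * \<bar>f z\<bar> powr p \<partial>lborel)"
proof -
  define Q where "Q = square m i j"
  define u where "u = square_average f m i j"
  define k where "k = p * sgn u * \<bar>u\<bar> powr (p - 1)"
  have [measurable]: "f \<in> borel_measurable borel" using f by (auto simp: Lp_def)
  have Q [measurable]: "Q \<in> sets borel" by (simp add: Q_def)
  have iQ: "integrable lborel (indicator Q :: _ \<Rightarrow> real)"
    by (rule integrable_real_indicator) (auto simp: Q_def)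
  have mQ: "measure lborel Q = 1 / 4 ^ m"
    by (simp add: measure_def Q_def)
  have if': "integrable lborel (\<lambda>z. indicator Q z * f z)"
    using Lp_square_integrable[OF p f] by (simp add: square_integrable_def Q_def)
  have ip: "integrable lborel (\<lambda>z. indicator Q z * \<bar>f z\<bar> powr p)"
    by (rule Bochner_Integration.integrable_bound[OF Lp_powr_integrable[OF f]])
      (auto simp: indicator_def)
  have "(\<integral>z. (\<bar>u\<bar> powr p - k * u) * indicator Q z + k * (indicator Q z * f z) \<partial>lborel)
      \<le> (\<integral>z. indicator Q z * \<bar>f z\<bar> powr p \<partial>lborel)"
  proof (rule integral_mono)
    fix z
    show "(\<bar>u\<bar> powr p - k * u) * indicator Q z + k * (indicator Q z * f z)
        \<le> indicator Q z * \<bar>f z\<bar> powr p"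
      using abs_powr_tangent[OF p, of u "f z"] by (auto simp: indicator_def k_def algebra_simps)
  qed (intro Bochner_Integration.integrable_add integrable_mult_right iQ if' ip)+
  also have "(\<integral>z. (\<bar>u\<bar> powr p - k * u) * indicator Q z + k * (indicator Q z * f z) \<partial>lborel)
      = (\<bar>u\<bar> powr p - k * u) * measure lborel Q + k * (\<integral>z. indicator Q z * f z \<partial>lborel)"
    by (subst Bochner_Integration.integral_add) (auto simp: iQ if')
  also have "(\<integral>z. indicator Q z * f z \<partial>lborel) = u * measure lborel Q"
    by (simp add: u_def square_average_def Q_def[symmetric] mQ)
  finally show ?thesis
    unfolding mQ Q_def[symmetric] u_def[symmetric] by (simp add: field_simps)
qed

lemma nn_integral_shift_sum_powr:
  "(\<integral>\<^sup>+z. ennreal (\<bar>shift_sum u n z\<bar> powr p) \<partial>lborel)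
     = ennreal ((\<Sum>i<2 ^ n. \<Sum>j<2 ^ n. \<bar>shifted u n i j\<bar> powr p) / 4 ^ n)"
proof -
  have "(\<integral>\<^sup>+z. ennreal (\<bar>shift_sum u n z\<bar> powr p) \<partial>lborel) =
     (\<integral>\<^sup>+z. (\<Sum>i<2 ^ n. \<Sum>j<2 ^ n. ennreal (\<bar>shifted u n i j\<bar> powr p) * indicator (square n i j) z) \<partial>lborel)"
    unfolding abs_shift_sum_powr
    by (simp only: sum_ennreal[symmetric] sum_nonneg mult_nonneg_nonneg powr_ge_zero indicator_pos_le
        ennreal_mult ennreal_indicator)
  also have "\<dots> = (\<Sum>i<2 ^ n. \<Sum>j<2 ^ n. ennreal (\<bar>shifted u n i j\<bar> powr p) * ennreal (1 / 4 ^ n))"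
    by (simp only: nn_integral_sum nn_integral_cmult_indicator square_measurable sets_lborel
        emeasure_square borel_measurable_sum borel_measurable_times_ennreal
        borel_measurable_const borel_measurable_indicator measurable_lborel1)
  also have "\<dots> = ennreal (\<Sum>i<2 ^ n. \<Sum>j<2 ^ n. \<bar>shifted u n i j\<bar> powr p * (1 / 4 ^ n))"
    by (simp only: sum_ennreal[symmetric] sum_nonneg mult_nonneg_nonneg powr_ge_zero
        ennreal_mult zero_le_divide_1_iff zero_le_power zero_le_numeral)
  finally show ?thesis by (simp add: sum_divide_distrib)
qed

lemma sum_square_integrals_le:
  fixes f :: "real \<times> real \<Rightarrow> real"
  assumes f: "integrable lborel f" "\<And>z. 0 \<le> f z"
  shows "(\<Sum>i<2 ^ n. \<Sum>j<2 ^ n. \<integral>z. indicator (square n i j) z * f z \<partial>lborel)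
     \<le> (\<integral>z. f z \<partial>lborel)"
proof -
  have [measurable]: "f \<in> borel_measurable borel" using f by auto
  have i: "integrable lborel (\<lambda>z. indicator (square n i j) z * f z)" for i j
    by (rule Bochner_Integration.integrable_bound[OF f(1)]) (auto simp: indicator_def)
  have "(\<Sum>i<2 ^ n. \<Sum>j<2 ^ n. \<integral>z. indicator (square n i j) z * f z \<partial>lborel)
    = (\<integral>z. (\<Sum>i<2 ^ n. \<Sum>j<2 ^ n. indicator (square n i j) z * f z) \<partial>lborel)"
    by (simp only: Bochner_Integration.integral_sum Bochner_Integration.integrable_sum i)
  also have "\<dots> \<le> (\<integral>z. f z \<partial>lborel)"
  proof (rule integral_mono)
    fix z :: "real \<times> real"
    have "(\<Sum>i<2 ^ n. \<Sum>j<2 ^ n. indicator (square n i j) z * f z) =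
       (\<Sum>i<2 ^ n. \<Sum>j<2 ^ n. 1 * indicator (square n i j) z) * f z"
      by (simp only: sum_distrib_right mult_1)
    also have "\<dots> \<le> 1 * f z"
      using f(2) by (intro mult_right_mono) (cases z, simp only: sum_indicator_squares, simp_all)
    finally show "(\<Sum>i<2 ^ n. \<Sum>j<2 ^ n. indicator (square n i j) z * f z) \<le> f z" by simp
  qed (intro Bochner_Integration.integrable_sum i f)+
  finally show ?thesis .
qed

text \<open>The tree inequality is applied to the averages of \<open>f\<close>, and Jensen's
  inequality returns to \<open>f\<close> itself. The factor \<open>4 ^ n\<close> from the averages
  cancels the area of the squares, so the bound is uniform in \<open>n\<close>.\<close>

lemma shift_sum_Lp_bound:
  assumes p: "1 < p" and c: "p - 1 \<le> c" "1 \<le> c * (p - 1)" and f: "f \<in> Lp p"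
  shows "(\<integral>\<^sup>+z. ennreal (\<bar>shift_sum (square_average f) n z\<bar> powr p) \<partial>lborel)
    \<le> ennreal (2 * burk_const p c * (\<integral>z. \<bar>f z\<bar> powr p \<partial>lborel))"
proof -
  define M where "M = 2 * burk_const p c"
  have M: "0 \<le> M" using burk_const_ge_1[OF p c] by (simp add: M_def burk_const_def)
  have "(\<Sum>i<2 ^ n. \<Sum>j<2 ^ n. \<bar>shifted (square_average f) n i j\<bar> powr p)
     \<le> M * (\<Sum>i<2 ^ n. \<Sum>j<2 ^ n. \<bar>square_average f n i j\<bar> powr p)"
    unfolding M_def
    by (intro shifted_Lp_bound[OF p c] square_average_split Lp_square_integrable[OF p f])
  also have "\<dots> \<le> M * (\<Sum>i<2 ^ n. \<Sum>j<2 ^ n.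
      4 ^ n * (\<integral>z. indicator (square n i j) z * \<bar>f z\<bar> powr p \<partial>lborel))"
    using M by (intro mult_left_mono sum_mono square_average_powr_le[OF p f])
  also have "\<dots> = 4 ^ n * (M * (\<Sum>i<2 ^ n. \<Sum>j<2 ^ n.
      \<integral>z. indicator (square n i j) z * \<bar>f z\<bar> powr p \<partial>lborel))"
    by (simp only: sum_distrib_left mult_ac)
  also have "\<dots> \<le> 4 ^ n * (M * (\<integral>z. \<bar>f z\<bar> powr p \<partial>lborel))"
    using M by (intro mult_left_mono sum_square_integrals_le Lp_powr_integrable[OF f]) auto
  finally show ?thesis
    unfolding nn_integral_shift_sum_powr M_def[symmetric]
    by (intro ennreal_leI) (simp add: field_simps)
qed

lemma enn_powr_le_1D:
  assumes "enn_powr x a \<le> 1" "0 < a"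
  shows "x \<le> 1"
proof (cases x)
  case (real r)
  have "r powr a \<le> 1"
    using assms(1) real by (simp add: enn_powr_ennreal)
  then have "\<not> 1 < r" using assms(2) gr_one_powr[of r a] by (meson not_le)
  then show ?thesis using real by simp
qed (use assms in \<open>simp add: enn_powr_def\<close>)

lemma Lp_op_norm_pi4_diagonal_symbol:
  assumes p: "1 < p" and c: "p - 1 \<le> c" "1 \<le> c * (p - 1)" and n: "0 < n"
  shows "Lp_op_norm p (pi4 (diagonal_symbol n))
    \<le> ennreal ((2 * burk_const p c) powr (1 / p) * sqrt n)"
  unfolding Lp_op_norm_def
proof (rule SUP_least)
  fix f assume "f \<in> {f \<in> Lp p. Lp_norm p f \<le> 1}"
  then have f: "f \<in> Lp p" "Lp_norm p f \<le> 1" by auto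
  define M where "M = 2 * burk_const p c"
  have M: "0 \<le> M" using burk_const_ge_1[OF p c] by (simp add: M_def burk_const_def)
  define A where "A = (\<integral>z. \<bar>f z\<bar> powr p \<partial>lborel)"
  have "(\<integral>\<^sup>+z. ennreal (\<bar>f z\<bar> powr p) \<partial>lborel) \<le> 1"
    using f(2) p unfolding Lp_norm_def by (rule_tac enn_powr_le_1D) auto
  then have A: "A \<le> 1"
    unfolding A_def using Lp_powr_integrable[OF f(1)] by (simp add: nn_integral_eq_integral)
  let ?T = "shift_sum (square_average f) n"
  have m: "(\<lambda>z. ennreal (\<bar>?T z\<bar> powr p)) \<in> borel_measurable lborel"
    unfolding abs_shift_sum_powr by measurable
  have "(\<integral>\<^sup>+z. ennreal (\<bar>pi4 (diagonal_symbol n) f z\<bar> powr p) \<partial>lborel)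
     = (\<integral>\<^sup>+z. ennreal (sqrt n powr p) * ennreal (\<bar>?T z\<bar> powr p) \<partial>lborel)"
    unfolding pi4_diagonal_symbol[OF n Lp_square_integrable[OF p f(1)]]
    by (simp add: abs_mult powr_mult ennreal_mult)
  also have "\<dots> = ennreal (sqrt n powr p) * (\<integral>\<^sup>+z. ennreal (\<bar>?T z\<bar> powr p) \<partial>lborel)"
    by (rule nn_integral_cmult[OF m])
  also have "\<dots> \<le> ennreal (sqrt n powr p) * ennreal (M * A)"
    unfolding M_def A_def by (intro mult_left_mono shift_sum_Lp_bound[OF p c f(1)]) simp
  also have "\<dots> \<le> ennreal (sqrt n powr p) * ennreal M"
    using M A by (intro mult_left_mono ennreal_leI) (auto simp: mult_left_le)
  also have "\<dots> = ennreal (sqrt n powr p * M)"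
    using M by (simp add: ennreal_mult)
  finally have "Lp_norm p (pi4 (diagonal_symbol n) f) \<le> enn_powr (ennreal (sqrt n powr p * M)) (1 / p)"
    unfolding Lp_norm_def using p by (intro enn_powr_mono) auto
  also have "\<dots> = ennreal (M powr (1 / p) * sqrt n)"
    using p M by (subst enn_powr_ennreal) (auto simp: powr_mult powr_powr mult.commute)
  finally show "Lp_norm p (pi4 (diagonal_symbol n) f)
      \<le> ennreal ((2 * burk_const p c) powr (1 / p) * sqrt n)"
    unfolding M_def .
qed

theorem mainTheorem3:
  fixes p :: real
  assumes "1 < p"
  shows "\<exists>C :: real. \<forall>n :: nat. (\<exists>k :: nat. n = 2 ^ k) \<longrightarrow>
           (\<exists>g :: real \<times> real \<Rightarrow> real.
              finite_haar_support g \<and>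
              product_bmo_norm g = ennreal (real n) \<and>
              Lp_op_norm p (pi4 g) \<le> ennreal (C * sqrt (real n)))"
proof -
  \<comment> \<open>The least value that satisfies both conditions on \<open>c\<close>; it depends
    on \<open>p\<close> only.\<close>
  define c where "c = max (p - 1) (1 / (p - 1))"
  have c: "p - 1 \<le> c" "1 \<le> c * (p - 1)"
    using assms by (simp_all add: c_def pos_divide_le_eq[symmetric])
  show ?thesis
  proof (intro exI[of _ "(2 * burk_const p c) powr (1 / p)"] allI impI)
    fix n :: nat assume "\<exists>k :: nat. n = 2 ^ k"
    then have n: "0 < n" by auto
    show "\<exists>g. finite_haar_support g \<and> product_bmo_norm g = ennreal (real n) \<and>
        Lp_op_norm p (pi4 g) \<le> ennreal ((2 * burk_const p c) powr (1 / p) * sqrt (real n))"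
      using finite_haar_support_diagonal_symbol[OF n] product_bmo_norm_diagonal_symbol[OF n]
        Lp_op_norm_pi4_diagonal_symbol[OF assms c n] by blast
  qed
qed

end
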